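(* Let $d\ge3$ and let $\mathcal{T}\in\mathbb{R}^{n_1\times\cdots\times n_d}$ satisfy $\mathcal{T}=(U_1^{\#},\dots,U_d^{\#}).\mathcal{G}^{\#}$ where $U_i^{\#}\in\mathbb{R}^{n_i\times r_i}_+$ with $(U_i^{\#})^\top e=e$ for $i\in[d]$ and $\mathcal{G}^{\#}\in\mathbb{R}^{r_1\times\cdots\times r_d}$, with $r_1=r_2=r$. Assume that $U_i^{\#}$ satisfies the SSC for all $i\in[d]$, and that for all $i\in\{2,\dots,d\}$ the indices $k^{(i)}=(k^{(i)}_1,\dots,k^{(i)}_{d-2})$ are such that $\operatorname{rank}(\mathcal{T}^{[1,i]}_{k^{(i)}})=r_i$. Let $(U_1^*,\dots,U_d^*,\mathcal{G}^* )$ be any output of the following procedure: 1. Let $(U_1^*,U_2^*,S_2^* )$ be an optimal solution of $$\min_{U_1\in\mathbb{R}^{n_1\times r},\,U_2\in\mathbb{R}^{n_2\times r},\,S_2\in\mathbb{R}^{r\times r}}|\det(S_2)|\ \text{ such that }\ \mathcal{T}^{[1,2]}_{k^{(2)}}=U_1S_2U_2^\top,\ U_i^\top e=e,\ U_i\ge0\text{ for }i\in\{1,2\}.$$ 2. For each $i\in\{3,\dots,d\}$, let $\mathcal{T}'_{k^{(i)}}=(U_1^* )^\dagger\mathcal{T}^{[1,i]}_{k^{(i)}}$ and let $(U_i^*,S_i^* )$ be an optimal solution of $$\min_{U_i\in\mathbb{R}^{n_i\times r_i},\,S_i\in\mathbb{R}^{r\times r_i}}\det(S_i^\top S_i)\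 \text{ such that }\ \mathcal{T}'_{k^{(i)}}=S_iU_i^\top,\ U_i^\top e=e,\ U_i\ge0.$$ 3. Let $\mathcal{G}^*=((U_1^* )^\dagger,\dots,(U_d^* )^\dagger).\mathcal{T}$. Then there exist permutation matrices $\Pi_i$ such that $U_i^*=U_i^{\#}\Pi_i$ for all $i\in[d]$ and $\mathcal{G}^*=(\Pi_1^\top,\dots,\Pi_d^\top).\mathcal{G}^{\#}$.
   Context: $[d]=\{1,\dots,d\}$, $e$ is the all-ones vector of appropriate dimension, $e_k$ the $k$-th standard basis vector, $\ge$ is entrywise, and $U^\dagger$ denotes the Moore-Penrose inverse. For $U_i\in\mathbb{R}^{n_i\times r_i}$ and $\mathcal{G}\in\mathbb{R}^{r_1\times\cdots\times r_d}$, $(U_1,\dots,U_d).\mathcal{G}\in\mathbb{R}^{n_1\times\cdots\times n_d}$ is the tensor with entries $\sum_{i_1,\dots,i_d}\big(\prod_{t=1}^d(U_t)_{j_t,i_t}\big)\mathcal{G}_{i_1,\dots,i_d}$. For $i<j$ in $[d]$, an $[i,j]$-slice of $\mathcal{T}$ is the $n_i\times n_j$ matrix $\mathcal{T}^{[i,j]}_k$ obtained by fixing the $d-2$ indices of the modes other than $i$ and $j$ to the tuple $k$ and letting the $i$-th index (rows) and the $j$-th index (columns) vary. For $A\in\mathbb{R}^{m\times n}$, $\operatorname{cone}(A)=\{Ay : y\in\mathbb{R}^n, y\ge 0\}$ and $\operatorname{cone}^*(A)=\{y\in\mathbb{R}^m : A^\top y\ge 0\}$. A matrix $H\in\mathbb{R}^{n\times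 r}_+$ with $r\ge2$ satisfies the sufficiently scattered condition (SSC) if: (SSC1) $\{x\in\mathbb{R}^r_+ : e^\top x\ge\sqrt{r-1}\,\|x\|_2\}\subseteq\operatorname{cone}(H^\top)$; and (SSC2) $\operatorname{cone}^*(H^\top)\cap\operatorname{bd}(\mathcal{C}^* )=\{\lambda e_k : \lambda\ge0,\ k\in\{1,\dots,r\}\}$, where $\mathcal{C}^*=\{x\in\mathbb{R}^r : e^\top x\ge\|x\|_2\}$ and $\operatorname{bd}$ denotes the boundary. *)

theory Defs
  imports
    "HOL-Combinatorics.Permutations"
    "HOL-Library.FuncSet"
    "HOL-Analysis.L2_Norm"
    "HOL-Analysis.Abstract_Metric_Spaces"
    "Jordan_Normal_Form.DL_Rank"
begin

(* Modes are numbered 1..d; matrix, vector and tensor entries are indexed from 0, following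
   Jordan_Normal_Form. A tensor of format n 1 x ... x n d is a function on multi-indices that is
   undefined outside the index set, so equality of tensors is equality of functions. *)

definition tensor_index :: "nat \<Rightarrow> (nat \<Rightarrow> nat) \<Rightarrow> (nat \<Rightarrow> nat) set" where
  "tensor_index d n = (\<Pi>\<^sub>E t\<in>{1..d}. {..<n t})"

definition tensors :: "nat \<Rightarrow> (nat \<Rightarrow> nat) \<Rightarrow> ((nat \<Rightarrow> nat) \<Rightarrow> real) set" where
  "tensors d n = tensor_index d n \<rightarrow>\<^sub>E UNIV"

definition multilinear_mult ::
  "nat \<Rightarrow> (nat \<Rightarrow> real mat) \<Rightarrow> ((nat \<Rightarrow> nat) \<Rightarrow> real) \<Rightarrow> ((nat \<Rightarrow> nat) \<Rightarrow> real)" where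
  "multilinear_mult d U G =
    (\<lambda>j \<in> tensor_index d (\<lambda>t. dim_row (U t)).
      \<Sum>i \<in> tensor_index d (\<lambda>t. dim_col (U t)). (\<Prod>t\<in>{1..d}. U t $$ (j t, i t)) * G i)"

(* The tuple fixing the modes of a d-way tensor of format n other than i and j. *)
definition slice_index :: "nat \<Rightarrow> (nat \<Rightarrow> nat) \<Rightarrow> nat \<Rightarrow> nat \<Rightarrow> (nat \<Rightarrow> nat) set" where
  "slice_index d n i j = (\<Pi>\<^sub>E t\<in>{1..d} - {i, j}. {..<n t})"

definition slice ::
  "(nat \<Rightarrow> nat) \<Rightarrow> ((nat \<Rightarrow> nat) \<Rightarrow> real) \<Rightarrow> nat \<Rightarrow> nat \<Rightarrow> (nat \<Rightarrow> nat) \<Rightarrow> real mat" where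
  "slice n T i j k = mat (n i) (n j) (\<lambda>(a, b). T (k(i := a, j := b)))"

definition ones_vec :: "nat \<Rightarrow> real vec" where
  "ones_vec n = vec n (\<lambda>_. 1)"

definition nonneg_vec :: "real vec \<Rightarrow> bool" where
  "nonneg_vec x \<longleftrightarrow> 0\<^sub>v (dim_vec x) \<le> x"

definition nonneg_mat :: "real mat \<Rightarrow> bool" where
  "nonneg_mat A \<longleftrightarrow> 0\<^sub>m (dim_row A) (dim_col A) \<le> A"

definition unit_col_sums :: "real mat \<Rightarrow> bool" where
  "unit_col_sums U \<longleftrightarrow> U\<^sup>T *\<^sub>v ones_vec (dim_row U) = ones_vec (dim_col U)"

definition permutation_mat :: "nat \<Rightarrow> real mat \<Rightarrow> bool" where
  "permutation_mat n P \<longleftrightarrow>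
    (\<exists>p. p permutes {..<n} \<and> P = mat n n (\<lambda>(i, j). if i = p j then 1 else 0))"

(* The Moore-Penrose inverse, characterised by the four Penrose equations. *)
definition is_mp_inverse :: "real mat \<Rightarrow> real mat \<Rightarrow> bool" where
  "is_mp_inverse A X \<longleftrightarrow>
    X \<in> carrier_mat (dim_col A) (dim_row A) \<and>
    A * X * A = A \<and> X * A * X = X \<and> (A * X)\<^sup>T = A * X \<and> (X * A)\<^sup>T = X * A"

definition mp_inverse :: "real mat \<Rightarrow> real mat" where
  "mp_inverse A = (THE X. is_mp_inverse A X)"

lemma is_mp_inverse_unique:
  assumes "is_mp_inverse A X" and "is_mp_inverse A Y"
  shows "X = Y"
proof -
  obtain m n where A: "A \<in> carrier_mat m n" by blast
  then have X: "X \<in> carrier_mat n m" and Y: "Y \<in> carrier_mat n m"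
    using assms by (auto simp: is_mp_inverse_def)
  note inv = assms[unfolded is_mp_inverse_def]
  note AX = mult_carrier_mat[OF A X] and AY = mult_carrier_mat[OF A Y]
    and XA = mult_carrier_mat[OF X A] and YA = mult_carrier_mat[OF Y A]
  have AXAY: "A * X = A * Y"
  proof -
    have "A * X = (A * Y * A) * X" using inv by simp
    also have "\<dots> = (A * Y) * (A * X)" by (rule assoc_mult_mat[OF AY A X])
    also have "\<dots> = (A * Y)\<^sup>T * (A * X)\<^sup>T" using inv by simp
    also have "\<dots> = ((A * X) * (A * Y))\<^sup>T" by (rule transpose_mult[OF AX AY, symmetric])
    also have "(A * X) * (A * Y) = (A * X * A) * Y"
      by (rule assoc_mult_mat[OF AX A Y, symmetric])
    also have "\<dots>\<^sup>T = A * Y" using inv by simp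
    finally show ?thesis .
  qed
  have XAYA: "X * A = Y * A"
  proof -
    have "X * A = X * (A * Y * A)" using inv by simp
    also have "A * Y * A = A * (Y * A)" by (rule assoc_mult_mat[OF A Y A])
    also have "X * (A * (Y * A)) = (X * A) * (Y * A)"
      by (rule assoc_mult_mat[OF X A YA, symmetric])
    also have "\<dots> = (X * A)\<^sup>T * (Y * A)\<^sup>T" using inv by simp
    also have "\<dots> = ((Y * A) * (X * A))\<^sup>T" by (rule transpose_mult[OF YA XA, symmetric])
    also have "(Y * A) * (X * A) = Y * (A * (X * A))" by (rule assoc_mult_mat[OF Y A XA])
    also have "A * (X * A) = A * X * A" by (rule assoc_mult_mat[OF A X A, symmetric])
    also have "(Y * (A * X * A))\<^sup>T = Y * A" using inv by simp
    finally show ?thesis .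
  qed
  have "X = X * A * X" using inv by simp
  also have "\<dots> = Y * A * X" by (simp only: XAYA)
  also have "\<dots> = Y * (A * X)" by (rule assoc_mult_mat[OF Y A X])
  also have "\<dots> = Y * A * Y" unfolding AXAY by (rule assoc_mult_mat[OF Y A Y, symmetric])
  also have "\<dots> = Y" using inv by simp
  finally show ?thesis .
qed

definition l2_norm_vec :: "real vec \<Rightarrow> real" where
  "l2_norm_vec x = L2_set (\<lambda>i. x $ i) {..<dim_vec x}"

(* The dimension is a parameter so that the distance is symmetric on all of real vec, as the
   locale Metric_space requires. *)
definition l2_dist_vec :: "nat \<Rightarrow> real vec \<Rightarrow> real vec \<Rightarrow> real" where
  "l2_dist_vec r x y = L2_set (\<lambda>i. x $ i - y $ i) {..<r}"

lemma Metric_space_carrier_vec: "Metric_space (carrier_vec r) (l2_dist_vec r)"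
proof
  fix x y :: "real vec"
  show "0 \<le> l2_dist_vec r x y" by (simp add: l2_dist_vec_def)
  show "l2_dist_vec r x y = l2_dist_vec r y x"
    by (simp add: l2_dist_vec_def L2_set_def power2_commute)
next
  fix x y :: "real vec"
  assume "x \<in> carrier_vec r" "y \<in> carrier_vec r"
  then show "l2_dist_vec r x y = 0 \<longleftrightarrow> x = y"
    by (auto simp: l2_dist_vec_def L2_set_eq_0_iff)
next
  fix x y z :: "real vec"
  have "L2_set (\<lambda>i. (x $ i - y $ i) + (y $ i - z $ i)) {..<r}
      \<le> l2_dist_vec r x y + l2_dist_vec r y z"
    unfolding l2_dist_vec_def by (rule L2_set_triangle_ineq)
  then show "l2_dist_vec r x z \<le> l2_dist_vec r x y + l2_dist_vec r y z"
    by (simp add: l2_dist_vec_def)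
qed

definition boundary_vec :: "nat \<Rightarrow> real vec set \<Rightarrow> real vec set" where
  "boundary_vec r S = Metric_space.mtopology (carrier_vec r) (l2_dist_vec r) frontier_of S"

definition mat_cone :: "real mat \<Rightarrow> real vec set" where
  "mat_cone A = {A *\<^sub>v y | y. y \<in> carrier_vec (dim_col A) \<and> nonneg_vec y}"

definition dual_mat_cone :: "real mat \<Rightarrow> real vec set" where
  "dual_mat_cone A = {y \<in> carrier_vec (dim_row A). nonneg_vec (A\<^sup>T *\<^sub>v y)}"

definition dual_ice_cream_cone :: "nat \<Rightarrow> real vec set" where
  "dual_ice_cream_cone r = {x \<in> carrier_vec r. ones_vec r \<bullet> x \<ge> l2_norm_vec x}"

definition SSC1 :: "real mat \<Rightarrow> bool" where
  "SSC1 H \<longleftrightarrow> (let r = dim_col H in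
    {x \<in> carrier_vec r. nonneg_vec x \<and> ones_vec r \<bullet> x \<ge> sqrt (real r - 1) * l2_norm_vec x}
      \<subseteq> mat_cone (H\<^sup>T))"

definition SSC2 :: "real mat \<Rightarrow> bool" where
  "SSC2 H \<longleftrightarrow> (let r = dim_col H in
    dual_mat_cone (H\<^sup>T) \<inter> boundary_vec r (dual_ice_cream_cone r)
      = {c \<cdot>\<^sub>v unit_vec r k | c k. c \<ge> 0 \<and> k < r})"

definition SSC :: "real mat \<Rightarrow> bool" where
  "SSC H \<longleftrightarrow> 2 \<le> dim_col H \<and> nonneg_mat H \<and> SSC1 H \<and> SSC2 H"

fun feasible_trifactorization :: "nat \<Rightarrow> real mat \<Rightarrow> real mat \<times> real mat \<times> real mat \<Rightarrow> bool" where
  "feasible_trifactorization r M (U1, U2, S) \<longleftrightarrow>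
    U1 \<in> carrier_mat (dim_row M) r \<and> U2 \<in> carrier_mat (dim_col M) r \<and> S \<in> carrier_mat r r \<and>
    M = U1 * S * U2\<^sup>T \<and>
    unit_col_sums U1 \<and> unit_col_sums U2 \<and> nonneg_mat U1 \<and> nonneg_mat U2"

fun feasible_bifactorization :: "nat \<Rightarrow> real mat \<Rightarrow> real mat \<times> real mat \<Rightarrow> bool" where
  "feasible_bifactorization r M (U, S) \<longleftrightarrow>
    U \<in> carrier_mat (dim_col M) r \<and> S \<in> carrier_mat (dim_row M) r \<and>
    M = S * U\<^sup>T \<and> unit_col_sums U \<and> nonneg_mat U"

end

theory Submission
  imports Defs
begin

text \<open>
  The rank assumption makes any two factorizations of the same slice differ by invertible r x r
  matrices Q, so each computed factor has the form U Q. Both U and U Q have unit column sums, and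
  U Q is nonnegative; dualizing (SSC1), every column q of Q satisfies e q = 1 and has norm at most 1,
  hence |det Q| is at most 1 by Hadamard's inequality. Minimality of the volume forces |det Q| = 1, so
  all columns have norm 1 and lie on the boundary of the dual ice cream cone, where (SSC2) identifies
  them as unit vectors. The core tensor then follows because, for U of full column rank and a
  permutation matrix P, the Moore-Penrose inverse of U P maps U to the transpose of P.
\<close>

text \<open>Nonnegativity of U and U Q does not make Q nonnegative, so Q is controlled only through
  duality: a column q with U q >= 0 pairs nonnegatively with cone(U^T). The constant sqrt(r - 1) in
  \<open>SSC1\<close> is the one for which the ice cream cone is inscribed in the orthant; its dual
  {x : e x >= ||x||} is circumscribed about the orthant and has the rays of the unit vectors on its
  boundary. The volume inequality comes from the middle factor: if the outer factors U become U Q,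
  the true middle factor is the computed one multiplied by the matrices Q. The true factorization is
  feasible, so optimality bounds |det Q| from below, provided that the optimal volume is nonzero.
  Rank enters only as an equation L M E = 1, which passes by associativity through regrouped
  products and through the compression by the pseudoinverse of the first computed factor. In the
  second step the middle factor need not be square, and its Gram determinant stands in for the
  squared determinant.\<close>

no_notation inner (infix "\<bullet>" 70)
no_notation vec_nth (infixl "$" 90)

section \<open>Full-rank factorizations\<close>

lemma index_mult_mat_sum:
  assumes "A \<in> carrier_mat m r" and "B \<in> carrier_mat r n" and "i < m" and "j < n"
  shows "(A * B) $$ (i, j) = (\<Sum>l<r. A $$ (i, l) * B $$ (l, j))"
  using assms by (auto simp: scalar_prod_def lessThan_atLeast0 intro!: sum.cong)

lemma scalar_prod_self_eq_0:
  fixes v :: "real vec"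
  assumes "v \<in> carrier_vec n" and "v \<bullet> v = 0"
  shows "v = 0\<^sub>v n"
proof -
  have "(\<Sum>i = 0..<n. v $ i * v $ i) = 0" using assms by (simp add: scalar_prod_def)
  then have "\<forall>i\<in>{0..<n}. v $ i * v $ i = 0" by (subst (asm) sum_nonneg_eq_0_iff) auto
  then show ?thesis using assms by (intro eq_vecI) auto
qed

lemma exists_inverse_mat:
  fixes A :: "'a :: field mat"
  assumes A: "A \<in> carrier_mat n n" and "Determinant.det A \<noteq> 0"
  shows "\<exists>X \<in> carrier_mat n n. X * A = 1\<^sub>m n"
proof (rule bexI)
  let ?X = "(1 / Determinant.det A) \<cdot>\<^sub>m adj_mat A"
  show "?X \<in> carrier_mat n n" using adj_mat(1)[OF A] by simp
  have "?X * A = (1 / Determinant.det A) \<cdot>\<^sub>m (adj_mat A * A)"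
    using adj_mat(1)[OF A] A by (simp add: mult_smult_assoc_mat)
  also have "\<dots> = 1\<^sub>m n" using adj_mat(3)[OF A] assms(2) by (auto intro!: eq_matI)
  finally show "?X * A = 1\<^sub>m n" .
qed

text \<open>If the Gram matrix kills v, then A v has squared norm v . (A^T A v) = 0, so v = 0 by
  injectivity.\<close>

lemma injective_mat_gram_inverse:
  fixes A :: "real mat"
  assumes A: "A \<in> carrier_mat m r"
    and inj: "\<And>v. v \<in> carrier_vec r \<Longrightarrow> A *\<^sub>v v = 0\<^sub>v m \<Longrightarrow> v = 0\<^sub>v r"
  shows "\<exists>X \<in> carrier_mat r r. X * (A\<^sup>T * A) = 1\<^sub>m r"
proof (rule exists_inverse_mat)
  let ?N = "A\<^sup>T * A"
  show N: "?N \<in> carrier_mat r r" using A by auto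
  have At: "A\<^sup>T \<in> carrier_mat r m" using A by auto
  show "Determinant.det ?N \<noteq> 0"
  proof
    assume "Determinant.det ?N = 0"
    then obtain v where v: "v \<in> carrier_vec r" "v \<noteq> 0\<^sub>v r" "?N *\<^sub>v v = 0\<^sub>v r"
      using det_0_iff_vec_prod_zero_field[OF N] by auto
    have Av: "A *\<^sub>v v \<in> carrier_vec m" using A v(1) by (rule mult_mat_vec_carrier)
    have "(A *\<^sub>v v) \<bullet> (A *\<^sub>v v) = (A\<^sup>T *\<^sub>v (A *\<^sub>v v)) \<bullet> v"
      by (rule transpose_vec_mult_scalar[OF A v(1) Av, symmetric])
    also have "\<dots> = 0" unfolding assoc_mult_mat_vec[OF At A v(1), symmetric] v(3) using v(1) by simp
    finally have "A *\<^sub>v v = 0\<^sub>v m" by (rule scalar_prod_self_eq_0[OF Av])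
    then show False using inj v by blast
  qed
qed

text \<open>E selects a maximal independent set of columns of M, and L is the left inverse (N^T
  N)^-1 N^T of the selected submatrix N.\<close>

lemma full_rank_compression:
  fixes M :: "real mat"
  assumes M: "M \<in> carrier_mat m n" and rank: "vec_space.rank m M = r"
  shows "\<exists>L \<in> carrier_mat r m. \<exists>E \<in> carrier_mat n r. L * M * E = 1\<^sub>m r"
proof -
  interpret vec_space "TYPE(real)" m .
  have "\<exists>S. finite S \<and> maximal S (\<lambda>T. T \<subseteq> set (cols M) \<and> lin_indpt T) \<and> {} \<subseteq> S"
  proof (rule maximal_exists_superset[of "set (cols M)"])
    show "{} \<subseteq> set (cols M) \<and> lin_indpt {}" by (simp add: lin_dep_def)
  qed simp_all
  then obtain S where S: "finite S" "maximal S (\<lambda>T. T \<subseteq> set (cols M) \<and> lin_indpt T)" by blast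
  then have sub: "S \<subseteq> set (cols M)" and ind: "lin_indpt S" unfolding maximal_def by blast+
  have card: "card S = r" using rank_card_indpt[OF M S(2)] rank by simp
  obtain vs where vs: "set vs = S" "distinct vs" using finite_distinct_list[OF S(1)] by blast
  then have len: "length vs = r" using card distinct_card by fastforce
  have "\<exists>c<n. vs ! j = col M c" if "j < r" for j
  proof -
    have "vs ! j \<in> set (cols M)" using that len vs(1) sub by (metis nth_mem subsetD)
    then show ?thesis using M by (auto simp: cols_def)
  qed
  then obtain f where f: "\<And>j. j < r \<Longrightarrow> f j < n \<and> vs ! j = col M (f j)" by metis
  let ?N = "mat_of_cols m vs"
  have N: "?N \<in> carrier_mat m r" using len by auto
  have vsc: "set vs \<subseteq> carrier_vec m" using vs sub M cols_dim by blast
  have cols: "cols ?N = vs" using vsc by simp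
  have "\<exists>L \<in> carrier_mat r m. L * ?N = 1\<^sub>m r"
  proof -
    have "\<exists>X \<in> carrier_mat r r. X * (?N\<^sup>T * ?N) = 1\<^sub>m r"
    \<comment> \<open>A nonzero kernel vector is a linear dependence of the set \<open>S\<close>
      because the columns \<open>vs\<close> are pairwise distinct.\<close>
    proof (rule injective_mat_gram_inverse[OF N], rule ccontr)
      fix v :: "real vec"
      assume "v \<in> carrier_vec r" "?N *\<^sub>v v = 0\<^sub>v m" "v \<noteq> 0\<^sub>v r"
      with lin_depI[OF N] cols vs have "lin_dep S" by metis
      with ind show False by contradiction
    qed
    then obtain X where X: "X \<in> carrier_mat r r" "X * (?N\<^sup>T * ?N) = 1\<^sub>m r" by blast
    have Nt: "?N\<^sup>T \<in> carrier_mat r m" using N by auto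
    have "X * ?N\<^sup>T * ?N = 1\<^sub>m r" using X(2) assoc_mult_mat[OF X(1) Nt N] by simp
    then show ?thesis using mult_carrier_mat[OF X(1) Nt] by blast
  qed
  then obtain L where L: "L \<in> carrier_mat r m" "L * ?N = 1\<^sub>m r" by blast
  let ?E = "mat n r (\<lambda>(i, j). if i = f j then 1 else 0) :: real mat"
  have E: "?E \<in> carrier_mat n r" by simp
  have "M * ?E = ?N"
  proof (rule eq_matI)
    fix i j assume ij: "i < dim_row ?N" "j < dim_col ?N"
    then have ij': "i < m" "j < r" using N len by auto
    have "(M * ?E) $$ (i, j) = (\<Sum>l = 0..<n. M $$ (i, l) * (if l = f j then 1 else 0))"
      using ij' M by (auto simp: scalar_prod_def intro!: sum.cong)
    also have "\<dots> = (\<Sum>l = 0..<n. if l = f j then M $$ (i, l) else 0)"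
      by (rule sum.cong) auto
    also have "\<dots> = M $$ (i, f j)" using f[OF ij'(2)] by simp
    also have "\<dots> = ?N $$ (i, j)" using f[OF ij'(2)] ij' M len by (simp add: mat_of_cols_index)
    finally show "(M * ?E) $$ (i, j) = ?N $$ (i, j)" .
  qed (use M len in auto)
  then have "L * M * ?E = 1\<^sub>m r" using assoc_mult_mat[OF L(1) M E] L(2) by simp
  then show ?thesis by (rule bexI[OF bexI[OF _ E] L(1)])
qed

text \<open>L X' and Y' E are square with product 1, hence inverse to each other. So (Y' E) (L X')
  can be inserted in front of Y', after which X' Y' is replaced by X Y; the factor X is treated
  symmetrically.\<close>

lemma full_rank_factor_unique:
  fixes X :: "'a :: field mat"
  assumes X: "X \<in> carrier_mat m r" and X': "X' \<in> carrier_mat m r"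
    and Y: "Y \<in> carrier_mat r n" and Y': "Y' \<in> carrier_mat r n"
    and L: "L \<in> carrier_mat r m" and E: "E \<in> carrier_mat n r"
    and eq: "X' * Y' = X * Y" and one: "L * (X * Y) * E = 1\<^sub>m r"
  shows "\<exists>Q \<in> carrier_mat r r. Y' = Q * Y \<and> X = X' * Q"
proof
  note [simp] = mult_carrier_mat[OF L X] mult_carrier_mat[OF L X'] mult_carrier_mat[OF Y E]
    mult_carrier_mat[OF Y' E] X X' Y Y' L E
  \<comment> \<open>This choice is forced: Y' = Q Y gives Y' E = Q (Y E), and L X is the inverse of
    Y E.\<close>
  let ?Q = "(Y' * E) * (L * X)"
  show Q: "?Q \<in> carrier_mat r r" by (rule mult_carrier_mat[of _ _ r]) simp_all
  note [simp] = Q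
  have split: "L * (Z * W) * E = (L * Z) * (W * E)"
    if Z: "Z \<in> carrier_mat m r" and W: "W \<in> carrier_mat r n" for Z W :: "'a mat"
    using assoc_mult_mat[OF L Z W] assoc_mult_mat[OF mult_carrier_mat[OF L Z] W E] by simp
  have "(L * X') * (Y' * E) = 1\<^sub>m r" using split[OF X' Y'] eq one by simp
  then have inv': "(Y' * E) * (L * X') = 1\<^sub>m r"
    by (rule mat_mult_left_right_inverse[rotated 2]) simp_all
  have "(L * X) * (Y * E) = 1\<^sub>m r" using split[OF X Y] one by simp
  then have inv: "(Y * E) * (L * X) = 1\<^sub>m r"
    by (rule mat_mult_left_right_inverse[rotated 2]) simp_all
  have "Y' = ((Y' * E) * (L * X')) * Y'" unfolding inv' by (rule left_mult_one_mat[OF Y', symmetric])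
  also have "\<dots> = (Y' * E) * ((L * X') * Y')"
    by (rule assoc_mult_mat[of _ r r _ r _ n]) simp_all
  also have "(L * X') * Y' = L * (X' * Y')" by (rule assoc_mult_mat[OF L X' Y'])
  also have "L * (X' * Y') = (L * X) * Y"
    unfolding eq by (rule assoc_mult_mat[OF L X Y, symmetric])
  also have "(Y' * E) * ((L * X) * Y) = ?Q * Y"
    by (rule assoc_mult_mat[of _ r r _ r _ n, symmetric]) simp_all
  finally have Y'Q: "Y' = ?Q * Y" .
  have "L * X * (Y * E) = 1\<^sub>m r" using split[OF X Y] one by simp
  then have inv: "(Y * E) * (L * X) = 1\<^sub>m r"
    by (rule mat_mult_left_right_inverse[rotated 2]) simp_all
  have "X = X * ((Y * E) * (L * X))" unfolding inv by (rule right_mult_one_mat[OF X, symmetric])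
  also have "\<dots> = (X * (Y * E)) * (L * X)"
    by (rule assoc_mult_mat[of _ m r _ r _ r, symmetric]) simp_all
  also have "X * (Y * E) = (X' * Y') * E" unfolding eq by (rule assoc_mult_mat[OF X Y E, symmetric])
  also have "\<dots> = X' * (Y' * E)" by (rule assoc_mult_mat[OF X' Y' E])
  also have "\<dots> * (L * X) = X' * ?Q"
    by (rule assoc_mult_mat[of _ m r _ r _ r]) simp_all
  finally show "Y' = ?Q * Y \<and> X = X' * ?Q" using Y'Q by blast
qed

text \<open>The square matrices in (L X) (Y E) = 1 may be exchanged; rebracketing (Y E) (L X) = 1
  shows Y E L as a left inverse of X and E L X as a right inverse of Y.\<close>

lemma full_rank_factor_inverses:
  fixes X :: "'a :: field mat"
  assumes X: "X \<in> carrier_mat m r" and Y: "Y \<in> carrier_mat r n"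
    and L: "L \<in> carrier_mat r m" and E: "E \<in> carrier_mat n r"
    and one: "L * (X * Y) * E = 1\<^sub>m r"
  shows "\<exists>A \<in> carrier_mat r m. A * X = 1\<^sub>m r" and "\<exists>A \<in> carrier_mat n r. Y * A = 1\<^sub>m r"
proof -
  have LX: "L * X \<in> carrier_mat r r" and YE: "Y * E \<in> carrier_mat r r" using L X Y E by simp_all
  have "L * (X * Y) * E = (L * X * Y) * E" using assoc_mult_mat[OF L X Y] by simp
  also have "\<dots> = (L * X) * (Y * E)" by (rule assoc_mult_mat[OF LX Y E])
  finally have "(L * X) * (Y * E) = 1\<^sub>m r" using one by simp
  then have inv: "(Y * E) * (L * X) = 1\<^sub>m r" by (rule mat_mult_left_right_inverse[OF LX YE])
  have "(Y * E) * L * X = 1\<^sub>m r" using assoc_mult_mat[OF YE L X] inv by simp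
  then show "\<exists>A \<in> carrier_mat r m. A * X = 1\<^sub>m r" using mult_carrier_mat[OF YE L] by blast
  have "Y * (E * (L * X)) = 1\<^sub>m r" using assoc_mult_mat[OF Y E LX] inv by simp
  then show "\<exists>A \<in> carrier_mat n r. Y * A = 1\<^sub>m r" using mult_carrier_mat[OF E LX] by blast
qed

section \<open>Gram determinants\<close>

text \<open>Hadamard's inequality by a Gram-Schmidt step on the first column: clearing it from the
  others is a column operation of determinant 1, makes the Gram matrix block diagonal and never
  lengthens a column. The lower bound serves the possibly non-square factor in
  \<open>bifactorization_unique\<close>.\<close>

lemma det_gram_bounds:
  fixes R :: "real mat"
  assumes "R \<in> carrier_mat m k"
  shows "0 \<le> Determinant.det (R\<^sup>T * R) \<and>
    Determinant.det (R\<^sup>T * R) \<le> (\<Prod>j<k. col R j \<bullet> col R j)"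
  using assms
proof (induction k arbitrary: R)
  case 0
  then have "R\<^sup>T * R \<in> carrier_mat 0 0" by simp
  then show ?case by simp
next
  case (Suc k)
  note R = Suc.prems
  define a where "a = (\<Sum>l<m. R $$ (l, 0) * R $$ (l, 0))"
  define b where "b j = (\<Sum>l<m. R $$ (l, 0) * R $$ (l, Suc j))" for j
  \<comment> \<open>Projection coefficient of column \<open>Suc j\<close> on column 0. If column 0
    vanishes, the quotient is 0 by convention and \<open>b j\<close> is 0 too, so
    \<open>c j * a = b j\<close> still holds.\<close>
  define c where "c j = b j / a" for j
  define R' where "R' = mat m k (\<lambda>(i, j). R $$ (i, Suc j) - c j * R $$ (i, 0))"
  define E :: "real mat" where
    "E = mat (Suc k) (Suc k) (\<lambda>(i, j). if i = j then 1 else if i = 0 then - c (j - 1) else 0)"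
  define W where
    "W = mat m (Suc k) (\<lambda>(i, j). if j = 0 then R $$ (i, 0) else R' $$ (i, j - 1))"
  have R': "R' \<in> carrier_mat m k" and E: "E \<in> carrier_mat (Suc k) (Suc k)"
    and W: "W \<in> carrier_mat m (Suc k)" by (simp_all add: R'_def E_def W_def)
  have a0: "a \<ge> 0" by (simp add: a_def sum_nonneg)
  have ca: "c j * a = b j" for j
  proof (cases "a = 0")
    case True
    then have "\<forall>l\<in>{..<m}. R $$ (l, 0) * R $$ (l, 0) = 0"
      unfolding a_def by (subst (asm) sum_nonneg_eq_0_iff) auto
    then show ?thesis using True by (simp add: b_def)
  qed (simp add: c_def)
  have col_dot: "col A i \<bullet> col A j = (\<Sum>l<m. A $$ (l, i) * A $$ (l, j))"
    if "A \<in> carrier_mat m q" "i < q" "j < q" for A :: "real mat" and q i j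
    using that by (auto simp: scalar_prod_def lessThan_atLeast0 intro!: sum.cong)
  have orth: "(\<Sum>l<m. R $$ (l, 0) * R' $$ (l, j)) = 0" if "j < k" for j
  proof -
    have "(\<Sum>l<m. R $$ (l, 0) * R' $$ (l, j)) = b j - c j * a"
      using that unfolding R'_def a_def b_def
      by (simp add: algebra_simps sum_subtractf sum_distrib_left)
    then show ?thesis using ca by simp
  qed
  \<comment> \<open>Pythagoras: the projection removes exactly \<open>c j * c j * a\<close> from the
    squared length.\<close>
  have norm': "col R' j \<bullet> col R' j \<le> col R (Suc j) \<bullet> col R (Suc j)" if "j < k" for j
  proof -
    have "col R' j \<bullet> col R' j = (\<Sum>l<m. R $$ (l, Suc j) * R $$ (l, Suc j)) - 2 * (c j * b j) + c j * (c j * a)"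
      using that unfolding col_dot[OF R' that that] unfolding R'_def a_def b_def
      by (simp add: algebra_simps sum_subtractf sum.distrib sum_distrib_left)
    also have "c j * (c j * a) = c j * b j" using ca by simp
    also have "c j * b j = c j * c j * a" using ca by simp
    finally show ?thesis using a0 col_dot[OF R, of "Suc j" "Suc j"] that by simp
  qed
  have RE: "R * E = W"
  proof (rule eq_matI)
    fix i j assume "i < dim_row W" "j < dim_col W"
    then have ij: "i < m" "j < Suc k" using W by auto
    have "(R * E) $$ (i, j) = (\<Sum>l<Suc k. R $$ (i, l) * E $$ (l, j))"
      using ij R E by (auto simp: scalar_prod_def lessThan_atLeast0 intro!: sum.cong)
    also have "\<dots> = R $$ (i, 0) * E $$ (0, j) + (\<Sum>l<k. R $$ (i, Suc l) * E $$ (Suc l, j))"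
      by (rule sum.lessThan_Suc_shift)
    also have "(\<Sum>l<k. R $$ (i, Suc l) * E $$ (Suc l, j))
        = (\<Sum>l<k. if Suc l = j then R $$ (i, Suc l) else 0)"
      using ij by (intro sum.cong) (auto simp: E_def)
    also have "\<dots> = (if j = 0 then 0 else R $$ (i, j))"
      using ij by (cases j) (auto simp: sum.delta)
    finally show "(R * E) $$ (i, j) = W $$ (i, j)"
      using ij by (cases j) (auto simp: E_def W_def R'_def)
  qed (use R E W in auto)
  have detE: "Determinant.det E = 1"
  proof -
    have "upper_triangular E" by (auto simp: E_def upper_triangular_def)
    then have "Determinant.det E = prod_list (diag_mat E)" by (rule det_upper_triangular[OF _ E])
    also have "\<dots> = (\<Prod>i = 0..<Suc k. E $$ (i, i))" using E by (simp add: prod_list_diag_prod)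
    also have "\<dots> = 1" by (rule prod.neutral) (simp add: E_def)
    finally show ?thesis .
  qed
  have gram: "R\<^sup>T * R \<in> carrier_mat (Suc k) (Suc k)" and Rt: "R\<^sup>T \<in> carrier_mat (Suc k) m"
    and Et: "E\<^sup>T \<in> carrier_mat (Suc k) (Suc k)" using R E by auto
  have "W\<^sup>T * W = (E\<^sup>T * R\<^sup>T) * (R * E)" using RE transpose_mult[OF R E] by simp
  also have "\<dots> = E\<^sup>T * (R\<^sup>T * (R * E))" by (rule assoc_mult_mat[OF Et Rt mult_carrier_mat[OF R E]])
  also have "R\<^sup>T * (R * E) = R\<^sup>T * R * E" by (rule assoc_mult_mat[OF Rt R E, symmetric])
  finally have WW: "W\<^sup>T * W = E\<^sup>T * (R\<^sup>T * R * E)" .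
  have 1: "Determinant.det (W\<^sup>T * W) = Determinant.det (R\<^sup>T * R)"
    unfolding WW using detE det_transpose[OF E]
    by (simp add: det_mult[OF Et mult_carrier_mat[OF gram E]] det_mult[OF gram E])
  have "W\<^sup>T * W = four_block_mat (mat 1 1 (\<lambda>_. a)) (0\<^sub>m 1 k) (0\<^sub>m k 1) (R'\<^sup>T * R')"
  proof (rule eq_matI)
    fix i j assume "i < dim_row (four_block_mat (mat 1 1 (\<lambda>_. a)) (0\<^sub>m 1 k) (0\<^sub>m k 1) (R'\<^sup>T * R'))"
      "j < dim_col (four_block_mat (mat 1 1 (\<lambda>_. a)) (0\<^sub>m 1 k) (0\<^sub>m k 1) (R'\<^sup>T * R'))"
    then have ij: "i < Suc k" "j < Suc k" using R' by auto
    have "(W\<^sup>T * W) $$ (i, j) = (\<Sum>l<m. W $$ (l, i) * W $$ (l, j))"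
      using ij W col_dot[OF W ij] by simp
    also have "\<dots> = four_block_mat (mat 1 1 (\<lambda>_. a)) (0\<^sub>m 1 k) (0\<^sub>m k 1) (R'\<^sup>T * R') $$ (i, j)"
      using ij R' orth col_dot[OF R']
      by (cases i; cases j) (auto simp: W_def a_def mult.commute)
    finally show "(W\<^sup>T * W) $$ (i, j)
      = four_block_mat (mat 1 1 (\<lambda>_. a)) (0\<^sub>m 1 k) (0\<^sub>m k 1) (R'\<^sup>T * R') $$ (i, j)" .
  qed (use W R' in auto)
  also have "Determinant.det \<dots> = Determinant.det (mat 1 1 (\<lambda>_. a)) * Determinant.det (R'\<^sup>T * R')"
    using R' by (intro det_four_block_mat_lower_left_zero) auto
  also have "Determinant.det (mat 1 1 (\<lambda>_. a)) = a" by (simp add: det_single)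
  finally have det: "Determinant.det (R\<^sup>T * R) = a * Determinant.det (R'\<^sup>T * R')" using 1 by simp
  have "Determinant.det (R'\<^sup>T * R') \<le> (\<Prod>j<k. col R' j \<bullet> col R' j)" using Suc.IH[OF R'] by blast
  also have "\<dots> \<le> (\<Prod>j<k. col R (Suc j) \<bullet> col R (Suc j))"
    using norm' col_dot[OF R'] by (intro prod_mono) (auto simp: sum_nonneg)
  finally have "a * Determinant.det (R'\<^sup>T * R') \<le> a * (\<Prod>j<k. col R (Suc j) \<bullet> col R (Suc j))"
    using a0 by (rule mult_left_mono)
  also have "a = col R 0 \<bullet> col R 0" using col_dot[OF R, of 0 0] by (simp add: a_def)
  finally show ?case unfolding det prod.lessThan_Suc_shift
    using a0 Suc.IH[OF R'] \<open>a = col R 0 \<bullet> col R 0\<close> by simp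
qed

section \<open>The sufficiently scattered condition\<close>

lemma nonneg_mat_iff:
  assumes "A \<in> carrier_mat m n"
  shows "nonneg_mat A \<longleftrightarrow> (\<forall>i<m. \<forall>j<n. 0 \<le> A $$ (i, j))"
  using assms by (auto simp: nonneg_mat_def less_eq_mat_def)

lemma unit_col_sums_iff:
  assumes "A \<in> carrier_mat m n"
  shows "unit_col_sums A \<longleftrightarrow> (\<forall>j<n. (\<Sum>i<m. A $$ (i, j)) = 1)"
proof -
  have "(A\<^sup>T *\<^sub>v ones_vec m) $ j = (\<Sum>i<m. A $$ (i, j))" if "j < n" for j
    using that assms by (auto simp: scalar_prod_def ones_vec_def lessThan_atLeast0 intro!: sum.cong)
  then show ?thesis using assms by (auto simp: unit_col_sums_def ones_vec_def vec_eq_iff)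
qed

lemma ones_vec_scalar_prod:
  assumes "x \<in> carrier_vec r"
  shows "ones_vec r \<bullet> x = (\<Sum>i<r. x $ i)"
  using assms by (auto simp: ones_vec_def scalar_prod_def lessThan_atLeast0 intro!: sum.cong)

lemma l2_norm_vec_eq:
  assumes "x \<in> carrier_vec r"
  shows "l2_norm_vec x = sqrt (\<Sum>i<r. (x $ i)\<^sup>2)"
  using assms by (auto simp: l2_norm_vec_def L2_set_def)

text \<open>Cauchy-Schwarz on the other r - 1 entries, whose sum is \<open>- p i\<close>. This bound
  keeps the test vector of the next lemma inside the orthant.\<close>

lemma square_le_of_sum_eq_0:
  fixes p :: "nat \<Rightarrow> real"
  assumes "(\<Sum>i<r. p i) = 0" and i: "i < r"
  shows "real r * (p i)\<^sup>2 \<le> (real r - 1) * (\<Sum>j<r. (p j)\<^sup>2)"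
proof -
  have rem: "(\<Sum>j<r. f j) = f i + (\<Sum>j\<in>{..<r} - {i}. f j)" for f :: "nat \<Rightarrow> real"
    using i by (simp add: sum.remove)
  have "(p i)\<^sup>2 = (\<Sum>j\<in>{..<r} - {i}. p j)\<^sup>2"
    using assms(1) rem[of p] by (simp add: eq_neg_iff_add_eq_0[symmetric])
  also have "\<dots> \<le> (\<Sum>j\<in>{..<r} - {i}. (p j)\<^sup>2) * card ({..<r} - {i})"
    by (rule sum_squared_le_sum_of_squares)
  also have "\<dots> = (\<Sum>j\<in>{..<r} - {i}. (p j)\<^sup>2) * (real r - 1)"
    using i by simp
  also have "(\<Sum>j\<in>{..<r} - {i}. (p j)\<^sup>2) = (\<Sum>j<r. (p j)\<^sup>2) - (p i)\<^sup>2"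
    using rem[of "\<lambda>j. (p j)\<^sup>2"] by simp
  finally show ?thesis by (simp add: algebra_simps)
qed

text \<open>
  The test vector is e - t p, on the boundary of the primal cone and on the side of e opposite to
  the deviation p of q from the barycentre e/r.
\<close>

lemma SSC1_sum_squares_le_1:
  assumes H: "H \<in> carrier_mat n r" and r: "2 \<le> r" and ssc: "SSC1 H"
    and q: "q \<in> carrier_vec r" and Hq: "nonneg_vec (H *\<^sub>v q)" and sum_q: "(\<Sum>i<r. q $ i) = 1"
  shows "(\<Sum>i<r. (q $ i)\<^sup>2) \<le> 1"
proof (rule ccontr)
  assume "\<not> ?thesis"
  then have s: "(\<Sum>i<r. (q $ i)\<^sup>2) > 1" by simp
  define p where "p i = q $ i - 1 / r" for i
  define P where "P = (\<Sum>i<r. (p i)\<^sup>2)"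
  \<comment> \<open>Since p is orthogonal to e, ||x||^2 = r + t^2 P and e x = r. Equality in the
    cone condition, (r - 1) ||x||^2 = r^2, amounts to t^2 P = r / (r - 1).\<close>
  define t where "t = sqrt (r / ((r - 1) * P))"
  define x where "x = vec r (\<lambda>i. 1 - t * p i)"
  have x: "x \<in> carrier_vec r" and xi: "\<And>i. i < r \<Longrightarrow> x $ i = 1 - t * p i"
    by (simp_all add: x_def)
  have sum_p: "(\<Sum>i<r. p i) = 0" using sum_q r by (simp add: p_def sum_subtractf)
  have "P = (\<Sum>i<r. (q $ i)\<^sup>2 - 2 / r * q $ i + 1 / r\<^sup>2)"
    unfolding P_def p_def by (rule sum.cong) (auto simp: power2_diff power_divide)
  also have "\<dots> = (\<Sum>i<r. (q $ i)\<^sup>2) - 2 / r * (\<Sum>i<r. q $ i) + r * (1 / r\<^sup>2)"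
    by (simp add: sum.distrib sum_subtractf sum_distrib_left)
  also have "\<dots> = (\<Sum>i<r. (q $ i)\<^sup>2) - 1 / r"
    using r by (simp add: sum_q power2_eq_square)
  finally have P_gt: "P > (r - 1) / r" using s r by (simp add: field_simps of_nat_diff)
  then have P0: "P > 0" using r by (smt (verit) divide_nonneg_nonneg of_nat_0_le_iff)
  have r1: "real (r - 1) > 0" "real (r - 1) = real r - 1" using r by auto
  have t0: "t > 0" and tP: "t\<^sup>2 * P = r / (r - 1)"
    using P0 r r1(1) by (auto simp: t_def)
  have tp1: "t * p i \<le> 1" if "i < r" for i
  proof -
    have "r * (t * p i)\<^sup>2 = t\<^sup>2 * (r * (p i)\<^sup>2)" by (simp add: power_mult_distrib)
    also have "\<dots> \<le> t\<^sup>2 * (real (r - 1) * P)"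
      using square_le_of_sum_eq_0[OF sum_p that] r1(2)
      by (intro mult_left_mono) (simp_all add: P_def)
    also have "\<dots> = real (r - 1) * (t\<^sup>2 * P)" by simp
    also have "\<dots> = r" using r1(1) by (simp add: tP)
    finally have "(t * p i)\<^sup>2 \<le> 1" using r by simp
    then show ?thesis using abs_square_le_1[of "t * p i"] by linarith
  qed
  have "nonneg_vec x" using tp1 by (auto simp: nonneg_vec_def less_eq_vec_def x_def)
  moreover have "sqrt (real r - 1) * l2_norm_vec x \<le> ones_vec r \<bullet> x"
  proof -
    have "(\<Sum>i<r. (x $ i)\<^sup>2) = (\<Sum>i<r. 1 - 2 * t * p i + t\<^sup>2 * (p i)\<^sup>2)"
      by (rule sum.cong) (auto simp: xi power2_diff power_mult_distrib)
    also have "\<dots> = r - 2 * t * (\<Sum>i<r. p i) + t\<^sup>2 * P"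
      by (simp add: sum.distrib sum_subtractf sum_distrib_left P_def)
    also have "\<dots> = r\<^sup>2 / (r - 1)"
      using r1 by (simp add: sum_p tP) (simp add: field_simps power2_eq_square)
    finally have sq: "(\<Sum>i<r. (x $ i)\<^sup>2) = r\<^sup>2 / (r - 1)" .
    have "sqrt (real r - 1) * l2_norm_vec x = sqrt ((real r - 1) * (r\<^sup>2 / (r - 1)))"
      unfolding l2_norm_vec_eq[OF x] sq real_sqrt_mult ..
    also have "(real r - 1) * (r\<^sup>2 / (r - 1)) = r\<^sup>2"
      unfolding r1(2)[symmetric] using r1(1) by simp
    also have "sqrt (r\<^sup>2) = r" by simp
    also have "\<dots> = (\<Sum>i<r. 1) - t * (\<Sum>i<r. p i)" by (simp add: sum_p)
    also have "\<dots> = ones_vec r \<bullet> x"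
      unfolding ones_vec_scalar_prod[OF x] by (simp add: xi sum_subtractf sum_distrib_left)
    finally show ?thesis by simp
  qed
  ultimately have "x \<in> mat_cone (H\<^sup>T)" using ssc x H by (auto simp: SSC1_def)
  then obtain y where y: "y \<in> carrier_vec n" "nonneg_vec y" and xy: "x = H\<^sup>T *\<^sub>v y"
    using H by (auto simp: mat_cone_def)
  \<comment> \<open>Moving \<open>H\<close> across the inner product leaves two nonnegative
    vectors.\<close>
  have "x \<bullet> q = y \<bullet> (H *\<^sub>v q)" unfolding xy by (rule transpose_vec_mult_scalar[OF H q y(1)])
  also have "\<dots> \<ge> 0"
    unfolding scalar_prod_def using y Hq H
    by (intro sum_nonneg mult_nonneg_nonneg) (auto simp: nonneg_vec_def less_eq_vec_def)
  finally have xq: "x \<bullet> q \<ge> 0" .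
  have "x \<bullet> q = (\<Sum>i<r. (1 - t * p i) * q $ i)"
    using q by (auto simp: scalar_prod_def lessThan_atLeast0 xi intro!: sum.cong)
  also have "\<dots> = (\<Sum>i<r. q $ i - t * (p i)\<^sup>2 - t / r * p i)"
    by (rule sum.cong) (auto simp: p_def power2_eq_square field_simps)
  also have "\<dots> = 1 - t * P"
    unfolding sum_subtractf sum_distrib_left[symmetric] by (simp add: sum_q sum_p P_def)
  finally have "t * P \<le> 1" using xq by simp
  \<comment> \<open>Squaring and inserting the value of t^2 P yields P <= (r - 1) / r, against
    \<open>P_gt\<close>, which encodes ||q|| > 1.\<close>
  then have "(t * P)\<^sup>2 \<le> 1" using t0 P0 by (simp add: power_le_one)
  also have "(t * P)\<^sup>2 = t\<^sup>2 * P * P" by (simp add: power2_eq_square)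
  finally have "r / (r - 1) * P \<le> 1" by (simp only: tP)
  then show False using P_gt r r1(1) by (simp add: field_simps)
qed

text \<open>A small move from q along -e leaves the cone: lowering every entry by \<delta> gives (e
  x)^2 - ||x||^2 = \<delta> (r - 1) (r \<delta> - 2) < 0.\<close>

lemma in_boundary_dual_ice_cream_cone:
  assumes q: "q \<in> carrier_vec r" and r: "2 \<le> r"
    and sum_q: "(\<Sum>i<r. q $ i) = 1" and sq_q: "(\<Sum>i<r. (q $ i)\<^sup>2) = 1"
  shows "q \<in> boundary_vec r (dual_ice_cream_cone r)"
proof -
  interpret Metric_space "carrier_vec r" "l2_dist_vec r" by (rule Metric_space_carrier_vec)
  let ?C = "dual_ice_cream_cone r"
  have sub: "?C \<subseteq> topspace mtopology" by (auto simp: dual_ice_cream_cone_def)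
  have "q \<in> ?C"
    using q sum_q sq_q by (simp add: dual_ice_cream_cone_def ones_vec_scalar_prod l2_norm_vec_eq)
  then have "q \<in> mtopology closure_of ?C" using closure_of_subset[OF sub] by blast
  moreover have "q \<notin> mtopology interior_of ?C"
  proof
    assume "q \<in> mtopology interior_of ?C"
    then obtain \<epsilon> where eps: "\<epsilon> > 0" and ball: "mball q \<epsilon> \<subseteq> ?C"
      by (auto simp: metric_interior_of)
    \<comment> \<open>The first bound keeps x in the ball, as its distance from q is at most r
      \<delta> <= \<epsilon> / 2; the second makes r \<delta> - 2 negative.\<close>
    define \<delta> where "\<delta> = min (\<epsilon> / (2 * r)) (1 / r)"
    have d0: "\<delta> > 0" using eps r by (simp add: \<delta>_def)
    have "\<delta> \<le> \<epsilon> / (2 * r)" "\<delta> \<le> 1 / r" by (simp_all add: \<delta>_def)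
    then have d1: "r * \<delta> < \<epsilon>" and d2: "r * \<delta> \<le> 1" using r eps by (simp_all add: field_simps)
    define x where "x = vec r (\<lambda>i. q $ i - \<delta>)"
    have x: "x \<in> carrier_vec r" by (simp add: x_def)
    have "l2_dist_vec r q x = L2_set (\<lambda>_. \<delta>) {..<r}"
      unfolding l2_dist_vec_def by (rule L2_set_cong) (auto simp: x_def)
    also have "\<dots> \<le> (\<Sum>_<r. \<bar>\<delta>\<bar>)" by (rule L2_set_le_sum_abs)
    also have "\<dots> < \<epsilon>" using d0 d1 by simp
    finally have "x \<in> ?C" using ball q x by auto
    then have le: "sqrt (\<Sum>i<r. (x $ i)\<^sup>2) \<le> (\<Sum>i<r. x $ i)"
      using x by (simp add: dual_ice_cream_cone_def ones_vec_scalar_prod l2_norm_vec_eq)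
    have sx: "(\<Sum>i<r. x $ i) = 1 - r * \<delta>" by (simp add: x_def sum_subtractf sum_q)
    have "(\<Sum>i<r. (x $ i)\<^sup>2) = (\<Sum>i<r. (q $ i)\<^sup>2 - 2 * \<delta> * q $ i + \<delta>\<^sup>2)"
      by (rule sum.cong) (auto simp: x_def power2_diff)
    also have "\<dots> = 1 - 2 * \<delta> + r * \<delta>\<^sup>2"
      by (simp add: sum.distrib sum_subtractf sum_distrib_left[symmetric] sum_q sq_q)
    finally have "1 - 2 * \<delta> + r * \<delta>\<^sup>2 \<le> (1 - r * \<delta>)\<^sup>2"
      using le sx sqrt_le_D by simp
    then have "0 \<le> \<delta> * ((real r - 1) * (r * \<delta> - 2))"
      by (simp add: power2_eq_square algebra_simps)
    then have "0 \<le> (real r - 1) * (r * \<delta> - 2)" using d0 by (simp add: zero_le_mult_iff)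
    then show False using r d2 by (simp add: zero_le_mult_iff)
  qed
  ultimately show ?thesis by (simp add: boundary_vec_def frontier_of_def)
qed

text \<open>Two equal columns would make the determinant vanish, so the position of the 1 is an
  injective function of the column on a finite set. It is extended by the identity, as
  \<open>permutes\<close> demands.\<close>

lemma permutation_mat_of_unit_cols:
  assumes Q: "Q \<in> carrier_mat r r" and det: "Determinant.det Q \<noteq> 0"
    and cols: "\<And>j. j < r \<Longrightarrow> \<exists>i<r. col Q j = unit_vec r i"
  shows "permutation_mat r Q"
proof -
  from cols obtain f where f: "\<And>j. j < r \<Longrightarrow> f j < r \<and> col Q j = unit_vec r (f j)" by metis
  define p where "p j = (if j < r then f j else j)" for j
  have "inj_on f {..<r}"
  proof (rule inj_onI, rule ccontr)
    fix i j assume "i \<in> {..<r}" "j \<in> {..<r}" "f i = f j" "i \<noteq> j"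
    then have "Determinant.det Q = 0" using f by (intro det_identical_cols[OF Q, of i j]) auto
    then show False using det by contradiction
  qed
  then have "inj_on p {..<r}" by (auto simp: p_def inj_on_def)
  moreover have "p ` {..<r} \<subseteq> {..<r}" using f by (auto simp: p_def)
  ultimately have "bij_betw p {..<r} {..<r}" by (simp add: bij_betw_def endo_inj_surj)
  then have "p permutes {..<r}" by (rule bij_imp_permutes) (simp add: p_def)
  moreover have "Q = mat r r (\<lambda>(i, j). if i = p j then 1 else 0)"
  proof (rule eq_matI)
    fix i j assume "i < dim_row (mat r r (\<lambda>(i, j). if i = p j then 1 else 0) :: real mat)"
      "j < dim_col (mat r r (\<lambda>(i, j). if i = p j then 1 else 0) :: real mat)"
    then have ij: "i < r" "j < r" by auto
    then have "Q $$ (i, j) = col Q j $ i" using Q by simp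
    also have "\<dots> = (if i = f j then 1 else 0)" using f[OF ij(2)] ij by (simp add: unit_vec_def)
    finally show "Q $$ (i, j) = mat r r (\<lambda>(i, j). if i = p j then 1 else 0) $$ (i, j)"
      using ij by (simp add: p_def)
  qed (use Q in auto)
  ultimately show ?thesis by (auto simp: permutation_mat_def)
qed

lemma SSC_volume:
  assumes H: "H \<in> carrier_mat n r" and ssc: "SSC H" and sums: "unit_col_sums H"
    and Q: "Q \<in> carrier_mat r r" and HQ: "nonneg_mat (H * Q)" "unit_col_sums (H * Q)"
  shows "\<bar>Determinant.det Q\<bar> \<le> 1"
    and "1 \<le> \<bar>Determinant.det Q\<bar> \<Longrightarrow> permutation_mat r Q"
proof -
  have r: "2 \<le> r" and ssc1: "SSC1 H" and ssc2: "SSC2 H" using ssc H by (auto simp: SSC_def)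
  have HQc: "H * Q \<in> carrier_mat n r" using H Q by simp
  define s where "s j = (\<Sum>i<r. (col Q j $ i)\<^sup>2)" for j
  have colc: "col Q j \<in> carrier_vec r" for j using Q by auto
  have Hcol: "nonneg_vec (H *\<^sub>v col Q j)" if "j < r" for j
  proof -
    have "(H *\<^sub>v col Q j) $ i = (H * Q) $$ (i, j)" if "i < n" for i
      using that \<open>j < r\<close> H Q by simp
    then show ?thesis
      using HQ(1) H that by (auto simp: nonneg_mat_iff[OF HQc] nonneg_vec_def less_eq_vec_def)
  qed
  have sum1: "(\<Sum>i<r. col Q j $ i) = 1" if j: "j < r" for j
  proof -
    \<comment> \<open>The column sums of \<open>H\<close> equal 1 and may be inserted as factors,
      which turns column sums of \<open>Q\<close> into those of \<open>H * Q\<close>.\<close>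
    have "(\<Sum>i<r. col Q j $ i) = (\<Sum>i<r. (\<Sum>l<n. H $$ (l, i)) * Q $$ (i, j))"
      using sums j Q by (intro sum.cong) (auto simp: unit_col_sums_iff[OF H])
    also have "\<dots> = (\<Sum>l<n. \<Sum>i<r. H $$ (l, i) * Q $$ (i, j))"
      unfolding sum_distrib_right by (rule sum.swap)
    also have "\<dots> = (\<Sum>l<n. (H * Q) $$ (l, j))"
      using H Q j by (auto simp: scalar_prod_def lessThan_atLeast0 intro!: sum.cong)
    also have "\<dots> = 1" using HQ(2) j by (simp add: unit_col_sums_iff[OF HQc])
    finally show ?thesis .
  qed
  have s01: "0 \<le> s j" "s j \<le> 1" if "j < r" for j
    unfolding s_def using SSC1_sum_squares_le_1[OF H r ssc1 colc Hcol sum1] that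
    by (auto intro: sum_nonneg)
  have "(Determinant.det Q)\<^sup>2 = Determinant.det (Q\<^sup>T * Q)"
    using Q by (simp add: det_mult[of _ r] det_transpose power2_eq_square)
  also have "\<dots> \<le> (\<Prod>j<r. col Q j \<bullet> col Q j)" using det_gram_bounds[OF Q] by blast
  also have "\<dots> = (\<Prod>j<r. s j)"
    using Q by (intro prod.cong)
      (auto simp: s_def scalar_prod_def power2_eq_square lessThan_atLeast0 intro!: sum.cong)
  finally have det_le: "(Determinant.det Q)\<^sup>2 \<le> (\<Prod>j<r. s j)" .
  also have "\<dots> \<le> 1" using s01 by (intro prod_le_1) auto
  finally show "\<bar>Determinant.det Q\<bar> \<le> 1" by (simp add: abs_square_le_1)
  assume big: "1 \<le> \<bar>Determinant.det Q\<bar>"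
  then have "1 \<le> (Determinant.det Q)\<^sup>2" by (metis abs_ge_zero one_le_power power2_abs)
  then have prod: "1 \<le> (\<Prod>j<r. s j)" using det_le by linarith
  have "\<exists>i<r. col Q j = unit_vec r i" if j: "j < r" for j
  proof -
    \<comment> \<open>All factors lie in [0, 1], so a product of at least 1 leaves no slack in any
      of them.\<close>
    have "(\<Prod>j<r. s j) = s j * (\<Prod>i\<in>{..<r} - {j}. s i)" using j by (simp add: prod.remove)
    also have "\<dots> \<le> s j * 1" using s01 j by (intro mult_left_mono prod_le_1) auto
    finally have "s j = 1" using prod s01[OF j] by linarith
    then have "col Q j \<in> boundary_vec r (dual_ice_cream_cone r)"
      using in_boundary_dual_ice_cream_cone[OF colc r sum1[OF j]] by (simp add: s_def)
    moreover have "col Q j \<in> dual_mat_cone (H\<^sup>T)"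
      using Hcol[OF j] colc H by (simp add: dual_mat_cone_def)
    ultimately have "col Q j \<in> {c \<cdot>\<^sub>v unit_vec r k | c k. c \<ge> 0 \<and> k < r}"
      using ssc2 H by (auto simp: SSC2_def)
    then obtain c k where ck: "col Q j = c \<cdot>\<^sub>v unit_vec r k" "k < r" by blast
    \<comment> \<open>\<open>SSC2\<close> yields only a ray; the entry sum 1 fixes the
      scale.\<close>
    have "(\<Sum>i<r. col Q j $ i) = (\<Sum>i<r. if i = k then c else 0)"
      unfolding ck(1) by (rule sum.cong) (auto simp: unit_vec_def)
    then have "c = 1" using sum1[OF j] ck(2) by simp
    then show ?thesis using ck by auto
  qed
  moreover have "Determinant.det Q \<noteq> 0" using big by auto
  ultimately show "permutation_mat r Q" using permutation_mat_of_unit_cols[OF Q] by blast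
qed

section \<open>Moore-Penrose inverses and permutations\<close>

text \<open>A left inverse means full column rank, where (A^T A)^-1 A^T solves the Penrose
  equations; their uniqueness identifies it with the definite description.\<close>

lemma mp_inverse_left_inverse:
  assumes A: "A \<in> carrier_mat m r" and L: "L \<in> carrier_mat r m" and LA: "L * A = 1\<^sub>m r"
  shows "mp_inverse A \<in> carrier_mat r m" and "mp_inverse A * A = 1\<^sub>m r"
proof -
  let ?N = "A\<^sup>T * A"
  have At: "A\<^sup>T \<in> carrier_mat r m" and N: "?N \<in> carrier_mat r r" using A by auto
  have "v = 0\<^sub>v r" if v: "v \<in> carrier_vec r" and Av: "A *\<^sub>v v = 0\<^sub>v m" for v
  proof -
    have "v = (L * A) *\<^sub>v v" using v LA by simp
    also have "\<dots> = L *\<^sub>v (A *\<^sub>v v)" by (rule assoc_mult_mat_vec[OF L A v])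
    also have "\<dots> = 0\<^sub>v r" unfolding Av using L by auto
    finally show ?thesis .
  qed
  then obtain Y where Y: "Y \<in> carrier_mat r r" and YN: "Y * ?N = 1\<^sub>m r"
    using injective_mat_gram_inverse[OF A] by blast
  have Yt: "Y\<^sup>T \<in> carrier_mat r r" using Y by simp
  have "?N\<^sup>T = ?N" using transpose_mult[OF At A] by simp
  then have NYt: "?N * Y\<^sup>T = 1\<^sub>m r" using arg_cong[OF YN, of transpose_mat] transpose_mult[OF Y N] by simp
  \<comment> \<open>The inverse of a symmetric matrix is symmetric, which is what the Penrose
    equation for \<open>A * ?X\<close> requires.\<close>
  have "Y = Y * (?N * Y\<^sup>T)" using NYt Y by simp
  also have "\<dots> = (Y * ?N) * Y\<^sup>T" by (rule assoc_mult_mat[OF Y N Yt, symmetric])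
  also have "\<dots> = Y\<^sup>T" using YN Yt by simp
  finally have sym: "Y\<^sup>T = Y" by simp
  let ?X = "Y * A\<^sup>T"
  have X: "?X \<in> carrier_mat r m" using Y At by simp
  have XA: "?X * A = 1\<^sub>m r" using assoc_mult_mat[OF Y At A] YN by simp
  have AX: "A * ?X = A * Y * A\<^sup>T" by (rule assoc_mult_mat[OF A Y At, symmetric])
  have "(A * ?X)\<^sup>T = ?X\<^sup>T * A\<^sup>T" by (rule transpose_mult[OF A X])
  also have "?X\<^sup>T = A * Y" using transpose_mult[OF Y At] sym by simp
  finally have "(A * ?X)\<^sup>T = A * ?X" using AX by simp
  moreover have "A * ?X * A = A" using assoc_mult_mat[OF A X A] XA A by simp
  ultimately have "is_mp_inverse A ?X"
    unfolding is_mp_inverse_def using X XA A by (simp add: left_mult_one_mat[OF X])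
  then have "mp_inverse A = ?X"
    unfolding mp_inverse_def by (rule the_equality) (erule is_mp_inverse_unique, fact)
  then show "mp_inverse A \<in> carrier_mat r m" and "mp_inverse A * A = 1\<^sub>m r" using X XA by simp_all
qed

lemma permutation_mat_inverse:
  assumes "permutation_mat r P"
  shows "P \<in> carrier_mat r r" and "P\<^sup>T * P = 1\<^sub>m r" and "P * P\<^sup>T = 1\<^sub>m r"
proof -
  from assms obtain p where p: "p permutes {..<r}"
    and P: "P = mat r r (\<lambda>(i, j). if i = p j then 1 else 0)"
    by (auto simp: permutation_mat_def)
  show Pc: "P \<in> carrier_mat r r" using P by simp
  show PtP: "P\<^sup>T * P = 1\<^sub>m r"
  proof (rule eq_matI)
    fix i j assume "i < dim_row (1\<^sub>m r :: real mat)" "j < dim_col (1\<^sub>m r :: real mat)"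
    then have ij: "i < r" "j < r" by auto
    have pi: "p i < r" using p ij by (metis lessThan_iff permutes_in_image)
    have "(P\<^sup>T * P) $$ (i, j) = (\<Sum>l<r. P $$ (l, i) * P $$ (l, j))"
      using ij Pc by (auto simp: scalar_prod_def lessThan_atLeast0 intro!: sum.cong)
    also have "\<dots> = (\<Sum>l<r. if l = p i then P $$ (l, j) else 0)"
      using ij by (intro sum.cong) (auto simp: P)
    also have "\<dots> = (if i = j then 1 else 0)"
      using pi ij permutes_inj[OF p] by (auto simp: P inj_eq)
    finally show "(P\<^sup>T * P) $$ (i, j) = 1\<^sub>m r $$ (i, j)" using ij by simp
  qed (use Pc in auto)
  show "P * P\<^sup>T = 1\<^sub>m r" using Pc PtP by (intro mat_mult_left_right_inverse[OF _ Pc PtP]) simp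
qed

text \<open>X = \<open>mp_inverse (A * P)\<close> satisfies X A P = 1, so X A is the inverse of P.
  This evaluates both the compressed slices of the second step and the core of the third.\<close>

lemma mp_inverse_mult_permutation:
  assumes A: "A \<in> carrier_mat m r" and L: "L \<in> carrier_mat r m" and LA: "L * A = 1\<^sub>m r"
    and perm: "permutation_mat r P"
  shows "mp_inverse (A * P) \<in> carrier_mat r m" and "mp_inverse (A * P) * A = P\<^sup>T"
proof -
  note P = permutation_mat_inverse[OF perm]
  have Pt: "P\<^sup>T \<in> carrier_mat r r" using P(1) by simp
  have AP: "A * P \<in> carrier_mat m r" using A P(1) by simp
  have PtL: "P\<^sup>T * L \<in> carrier_mat r m" using Pt L by simp
  have "P\<^sup>T * L * (A * P) = P\<^sup>T * (L * (A * P))" by (rule assoc_mult_mat[OF Pt L AP])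
  also have "L * (A * P) = P" using assoc_mult_mat[OF L A P(1)] LA P(1) by simp
  finally have "P\<^sup>T * L * (A * P) = 1\<^sub>m r" using P(2) by simp
  note X = mp_inverse_left_inverse[OF AP PtL this]
  show Xc: "mp_inverse (A * P) \<in> carrier_mat r m" by (rule X(1))
  have XA: "mp_inverse (A * P) * A \<in> carrier_mat r r" using Xc A by simp
  have "mp_inverse (A * P) * A = mp_inverse (A * P) * A * (P * P\<^sup>T)"
    unfolding P(3) by (rule right_mult_one_mat[OF XA, symmetric])
  also have "\<dots> = mp_inverse (A * P) * A * P * P\<^sup>T" by (rule assoc_mult_mat[OF XA P(1) Pt, symmetric])
  also have "mp_inverse (A * P) * A * P = 1\<^sub>m r" using assoc_mult_mat[OF Xc A P(1)] X(2) by simp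
  finally show "mp_inverse (A * P) * A = P\<^sup>T" using Pt by simp
qed

section \<open>Minimum-volume factorizations\<close>

text \<open>Cancelling the right factor and then the left one gives B = Q1 R Q2, V1 = U1 Q1 and V2 =
  U2 Q2^T, so the two transition determinants share one optimality inequality.\<close>

lemma trifactorization_unique:
  assumes U1: "U1 \<in> carrier_mat m r" "SSC U1" "unit_col_sums U1"
    and U2: "U2 \<in> carrier_mat n r" "SSC U2" "unit_col_sums U2"
    and B: "B \<in> carrier_mat r r" and M: "M = U1 * B * U2\<^sup>T" and rank: "vec_space.rank m M = r"
    and opt: "is_arg_min (\<lambda>(V1, V2, R). \<bar>Determinant.det R\<bar>) (feasible_trifactorization r M)
      (V1, V2, R)"
  shows "\<exists>P1 P2. permutation_mat r P1 \<and> permutation_mat r P2 \<and> V1 = U1 * P1 \<and> V2 = U2 * P2"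
proof -
  have Mc: "M \<in> carrier_mat m n" using U1 U2 B M by simp
  have "feasible_trifactorization r M (V1, V2, R)" using opt unfolding is_arg_min_def by blast
  then have V1: "V1 \<in> carrier_mat m r" "unit_col_sums V1" "nonneg_mat V1"
    and V2: "V2 \<in> carrier_mat n r" "unit_col_sums V2" "nonneg_mat V2"
    and R: "R \<in> carrier_mat r r" and MV: "M = V1 * R * V2\<^sup>T"
    using Mc by auto
  have U2t: "U2\<^sup>T \<in> carrier_mat r n" and V2t: "V2\<^sup>T \<in> carrier_mat r n" using U2 V2 by auto
  have feas: "feasible_trifactorization r M (U1, U2, B)"
    using U1 U2 B M Mc by (simp add: SSC_def)
  have le: "\<bar>Determinant.det R\<bar> \<le> \<bar>Determinant.det B\<bar>"
    using is_arg_min_linorder[THEN iffD1, OF opt, THEN conjunct2, rule_format, OF feas] by simp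
  obtain L E where L: "L \<in> carrier_mat r m" and E: "E \<in> carrier_mat n r" and one: "L * M * E = 1\<^sub>m r"
    using full_rank_compression[OF Mc rank] by blast
  have U1B: "U1 * B \<in> carrier_mat m r" and V1R: "V1 * R \<in> carrier_mat m r"
    and U2E: "U2\<^sup>T * E \<in> carrier_mat r r" and LU1: "L * U1 \<in> carrier_mat r r"
    using U1 B V1 R U2t E L by simp_all
  obtain Q2 where Q2: "Q2 \<in> carrier_mat r r" "V2\<^sup>T = Q2 * U2\<^sup>T" "U1 * B = V1 * R * Q2"
    using full_rank_factor_unique[OF U1B V1R U2t V2t L E] MV M one by auto
  have RQ2: "R * Q2 \<in> carrier_mat r r" using R Q2 by simp
  \<comment> \<open>Once the right factor is cancelled, \<open>U2\<^sup>T * E\<close> replaces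
    \<open>E\<close> as right compression of \<open>U1 * B\<close>.\<close>
  have "L * M * E = L * (U1 * B) * U2\<^sup>T * E" unfolding M assoc_mult_mat[OF L U1B U2t] ..
  also have "\<dots> = L * (U1 * B) * (U2\<^sup>T * E)"
    by (rule assoc_mult_mat[OF mult_carrier_mat[OF L U1B] U2t E])
  finally have one1: "L * (U1 * B) * (U2\<^sup>T * E) = 1\<^sub>m r" using one by simp
  have eq1: "U1 * B = V1 * (R * Q2)" using Q2(3) assoc_mult_mat[OF V1(1) R Q2(1)] by simp
  \<comment> \<open>True and computed factors swap roles compared with \<open>Q2\<close>, so that
    \<open>Q1\<close> multiplies \<open>U1\<close> from the right.\<close>
  obtain Q1 where Q1: "Q1 \<in> carrier_mat r r" "B = Q1 * (R * Q2)" "V1 = U1 * Q1"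
    using full_rank_factor_unique[OF V1(1) U1(1) RQ2 B L U2E eq1] one1 eq1 by auto
  have detB: "Determinant.det B = Determinant.det Q1 * (Determinant.det R * Determinant.det Q2)"
    using Q1 R Q2 by (simp add: det_mult[OF Q1(1) RQ2] det_mult[OF R Q2(1)])
  have "L * U1 * B * (U2\<^sup>T * E) = 1\<^sub>m r" using one1 assoc_mult_mat[OF L U1(1) B] by simp
  then have "Determinant.det (L * U1) * Determinant.det B * Determinant.det (U2\<^sup>T * E) = 1"
    using det_mult[OF mult_carrier_mat[OF LU1 B] U2E] det_mult[OF LU1 B] by simp
  then have B0: "Determinant.det B \<noteq> 0" using one1 by auto
  have V2': "V2 = U2 * Q2\<^sup>T"
    using arg_cong[OF Q2(2), of transpose_mat] transpose_mult[OF Q2(1) U2t] by simp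
  have Q2t: "Q2\<^sup>T \<in> carrier_mat r r" using Q2(1) by simp
  note vol1 = SSC_volume[OF U1 Q1(1), folded Q1(3), OF V1(3,2)]
  note vol2 = SSC_volume[OF U2 Q2t, folded V2', OF V2(3,2)]
  define x y z where "x = \<bar>Determinant.det Q1\<bar>" and "y = \<bar>Determinant.det Q2\<bar>" and "z = \<bar>Determinant.det R\<bar>"
  have xy: "0 \<le> x" "x \<le> 1" "0 \<le> y" "y \<le> 1"
    using vol1(1) vol2(1) det_transpose[OF Q2(1)] by (simp_all add: x_def y_def)
  \<comment> \<open>A nonzero det B makes z positive, so z <= x z y can be divided by z; then x and
    y, both at most 1, must equal 1.\<close>
  have z: "z > 0" "z \<le> x * (z * y)" using B0 le by (auto simp: detB x_def y_def z_def abs_mult)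
  then have "z * 1 \<le> z * (x * y)" by (simp add: mult_ac)
  then have "1 \<le> x * y" using z(1) by (simp only: mult_le_cancel_left_pos)
  moreover have "x * y \<le> x" "x * y \<le> y" using xy by (simp_all add: mult_left_le mult_left_le_one_le)
  ultimately have "1 \<le> x" "1 \<le> y" by linarith+
  then have "permutation_mat r Q1" "permutation_mat r Q2\<^sup>T"
    using vol1(2) vol2(2) det_transpose[OF Q2(1)] by (simp_all add: x_def y_def)
  then show ?thesis using Q1(3) V2' by blast
qed

text \<open>B = R Q gives det (B^T B) = (det Q)^2 det (R^T R). Full rank is assumed as an equation
  because for a compressed slice that is the form inherited from the original slice.\<close>

lemma bifactorization_unique:
  assumes U: "U \<in> carrier_mat n s" "SSC U" "unit_col_sums U"
    and B: "B \<in> carrier_mat r s" and M: "M = B * U\<^sup>T"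
    and L: "L \<in> carrier_mat s r" and E: "E \<in> carrier_mat n s" and one: "L * M * E = 1\<^sub>m s"
    and opt: "is_arg_min (\<lambda>(V, R). Determinant.det (R\<^sup>T * R)) (feasible_bifactorization s M) (V, R)"
  shows "\<exists>P. permutation_mat s P \<and> V = U * P"
proof -
  have Mc: "M \<in> carrier_mat r n" using U B M by simp
  have "feasible_bifactorization s M (V, R)" using opt unfolding is_arg_min_def by blast
  then have V: "V \<in> carrier_mat n s" "unit_col_sums V" "nonneg_mat V"
    and R: "R \<in> carrier_mat r s" and MV: "M = R * V\<^sup>T"
    using Mc by auto
  have Ut: "U\<^sup>T \<in> carrier_mat s n" and Vt: "V\<^sup>T \<in> carrier_mat s n" using U V by auto
  have feas: "feasible_bifactorization s M (U, B)" using U B M Mc by (simp add: SSC_def)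
  have le: "Determinant.det (R\<^sup>T * R) \<le> Determinant.det (B\<^sup>T * B)"
    using is_arg_min_linorder[THEN iffD1, OF opt, THEN conjunct2, rule_format, OF feas] by simp
  obtain Q where Q: "Q \<in> carrier_mat s s" "V\<^sup>T = Q * U\<^sup>T" "B = R * Q"
    using full_rank_factor_unique[OF B R Ut Vt L E] MV M one by auto
  have V': "V = U * Q\<^sup>T"
    using arg_cong[OF Q(2), of transpose_mat] transpose_mult[OF Q(1) Ut] by simp
  have Qt: "Q\<^sup>T \<in> carrier_mat s s" and Rt: "R\<^sup>T \<in> carrier_mat s r" and G: "R\<^sup>T * R \<in> carrier_mat s s"
    using Q(1) R by auto
  have "B\<^sup>T * B = Q\<^sup>T * R\<^sup>T * (R * Q)" unfolding Q(3) transpose_mult[OF R Q(1)] ..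
  also have "\<dots> = Q\<^sup>T * (R\<^sup>T * (R * Q))" by (rule assoc_mult_mat[OF Qt Rt mult_carrier_mat[OF R Q(1)]])
  also have "R\<^sup>T * (R * Q) = R\<^sup>T * R * Q" by (rule assoc_mult_mat[OF Rt R Q(1), symmetric])
  finally have detB: "Determinant.det (B\<^sup>T * B) = (Determinant.det Q)\<^sup>2 * Determinant.det (R\<^sup>T * R)"
    by (simp add: det_mult[OF Qt mult_carrier_mat[OF G Q(1)]] det_mult[OF G Q(1)]
        det_transpose[OF Q(1)] power2_eq_square)
  \<comment> \<open>A left inverse makes R injective, so its Gram determinant is positive and
    cancels from the optimality inequality.\<close>
  obtain A where A: "A \<in> carrier_mat s r" "A * R = 1\<^sub>m s"
    using full_rank_factor_inverses(1)[OF R Vt L E] MV one by auto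
  have "Determinant.det (R\<^sup>T * R) \<noteq> 0"
  proof -
    have "v = 0\<^sub>v s" if v: "v \<in> carrier_vec s" and Rv: "R *\<^sub>v v = 0\<^sub>v r" for v
    proof -
      have "v = (A * R) *\<^sub>v v" using v A by simp
      also have "\<dots> = A *\<^sub>v (R *\<^sub>v v)" by (rule assoc_mult_mat_vec[OF A(1) R v])
      also have "\<dots> = 0\<^sub>v s" unfolding Rv using A by auto
      finally show ?thesis .
    qed
    then obtain X where X: "X \<in> carrier_mat s s" "X * (R\<^sup>T * R) = 1\<^sub>m s"
      using injective_mat_gram_inverse[OF R] by blast
    then have "Determinant.det X * Determinant.det (R\<^sup>T * R) = 1" using det_mult[OF X(1) G] by simp
    then show ?thesis by auto
  qed
  then have pos: "Determinant.det (R\<^sup>T * R) > 0" using det_gram_bounds[OF R] by simp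
  then have "1 \<le> (Determinant.det Q)\<^sup>2" using le by (simp add: detB)
  then have "1 \<le> \<bar>Determinant.det Q\<^sup>T\<bar>"
    unfolding det_transpose[OF Q(1)] by (metis abs_le_square_iff abs_1 one_power2)
  then show ?thesis
    using SSC_volume(2)[OF U Qt, folded V', OF V(3,2)] V' by blast
qed

section \<open>Multilinear multiplication\<close>

lemma multilinear_mult_cong:
  assumes "\<And>t. t \<in> {1..d} \<Longrightarrow> A t = A' t"
  shows "multilinear_mult d A G = multilinear_mult d A' G"
proof -
  have "tensor_index d (\<lambda>t. dim_row (A t)) = tensor_index d (\<lambda>t. dim_row (A' t))"
    "tensor_index d (\<lambda>t. dim_col (A t)) = tensor_index d (\<lambda>t. dim_col (A' t))"
    unfolding tensor_index_def using assms by (auto intro!: PiE_cong)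
  moreover have "(\<Prod>t\<in>{1..d}. A t $$ (j t, i t)) = (\<Prod>t\<in>{1..d}. A' t $$ (j t, i t))" for i j
    using assms by (intro prod.cong) auto
  ultimately show ?thesis by (simp only: multilinear_mult_def)
qed

text \<open>After exchanging the sums, the sum over intermediate multi-indices splits into one
  matrix product per mode.\<close>

lemma multilinear_mult_comp:
  assumes "\<And>t. t \<in> {1..d} \<Longrightarrow> dim_col (A t) = dim_row (U t)"
  shows "multilinear_mult d A (multilinear_mult d U G) = multilinear_mult d (\<lambda>t. A t * U t) G"
proof -
  let ?I = "tensor_index d (\<lambda>t. dim_row (U t))"
  let ?K = "tensor_index d (\<lambda>t. dim_col (U t))"
  have I: "tensor_index d (\<lambda>t. dim_col (A t)) = ?I"
    unfolding tensor_index_def using assms by (intro PiE_cong) auto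
  have "(\<Sum>i\<in>?I. (\<Prod>t\<in>{1..d}. A t $$ (j t, i t)) * (\<Sum>l\<in>?K. (\<Prod>t\<in>{1..d}. U t $$ (i t, l t)) * G l))
      = (\<Sum>l\<in>?K. (\<Prod>t\<in>{1..d}. (A t * U t) $$ (j t, l t)) * G l)"
    if j: "j \<in> tensor_index d (\<lambda>t. dim_row (A t))" for j
  proof -
    have "(\<Sum>i\<in>?I. (\<Prod>t\<in>{1..d}. A t $$ (j t, i t)) * (\<Sum>l\<in>?K. (\<Prod>t\<in>{1..d}. U t $$ (i t, l t)) * G l))
        = (\<Sum>i\<in>?I. \<Sum>l\<in>?K. (\<Prod>t\<in>{1..d}. A t $$ (j t, i t) * U t $$ (i t, l t)) * G l)"
      by (simp add: sum_distrib_left prod.distrib mult.assoc)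
    also have "\<dots> = (\<Sum>l\<in>?K. (\<Sum>i\<in>?I. \<Prod>t\<in>{1..d}. A t $$ (j t, i t) * U t $$ (i t, l t)) * G l)"
      by (subst sum.swap) (simp add: sum_distrib_right)
    \<comment> \<open>Distributivity read backwards: a sum over all choice functions of a product is
      a product of sums.\<close>
    also have "\<dots> = (\<Sum>l\<in>?K. (\<Prod>t\<in>{1..d}. \<Sum>s<dim_row (U t). A t $$ (j t, s) * U t $$ (s, l t)) * G l)"
      by (subst prod_sum_PiE) (simp_all add: tensor_index_def)
    also have "\<dots> = (\<Sum>l\<in>?K. (\<Prod>t\<in>{1..d}. (A t * U t) $$ (j t, l t)) * G l)"
    proof (intro sum.cong refl arg_cong2[where f = "(*)"] prod.cong)
      fix l t assume lt: "l \<in> ?K" "t \<in> {1..d}"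
      then have "l t < dim_col (U t)" "j t < dim_row (A t)"
        using j by (auto simp: tensor_index_def PiE_iff)
      then show "(\<Sum>s<dim_row (U t). A t $$ (j t, s) * U t $$ (s, l t)) = (A t * U t) $$ (j t, l t)"
        using assms[OF lt(2)]
        by (auto simp: scalar_prod_def lessThan_atLeast0 intro!: sum.cong)
    qed
    finally show ?thesis .
  qed
  then show ?thesis
    unfolding multilinear_mult_def I by (simp cong: restrict_cong)
qed

text \<open>The witness B contracts G over all modes except p and q, weighting mode t by the row
  \<open>\<kappa> t\<close> of \<open>U t\<close>.\<close>

lemma slice_multilinear_mult:
  assumes U: "\<And>t. t \<in> {1..d} \<Longrightarrow> U t \<in> carrier_mat (n t) (rs t)"
    and pq: "p \<in> {1..d}" "q \<in> {1..d}" "p \<noteq> q" and \<kappa>: "\<kappa> \<in> slice_index d n p q"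
  shows "\<exists>B \<in> carrier_mat (rs p) (rs q).
    slice n (multilinear_mult d U G) p q \<kappa> = U p * B * (U q)\<^sup>T"
proof
  let ?D = "{1..d} - {p, q}"
  let ?K = "slice_index d rs p q"
  let ?B = "mat (rs p) (rs q)
    (\<lambda>(x, y). \<Sum>m\<in>?K. (\<Prod>t\<in>?D. U t $$ (\<kappa> t, m t)) * G (m(p := x, q := y)))"
  show B: "?B \<in> carrier_mat (rs p) (rs q)" by simp
  have Up: "U p \<in> carrier_mat (n p) (rs p)" and Uq: "U q \<in> carrier_mat (n q) (rs q)"
    using U pq by blast+
  have rows: "tensor_index d (\<lambda>t. dim_row (U t)) = tensor_index d n"
    and cols: "tensor_index d (\<lambda>t. dim_col (U t)) = tensor_index d rs"
    unfolding tensor_index_def using U[THEN carrier_matD(1)] U[THEN carrier_matD(2)]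
    by (auto intro!: PiE_cong)
  have ins: "{1..d} = insert p (insert q ?D)" using pq by auto
  show "slice n (multilinear_mult d U G) p q \<kappa> = U p * ?B * (U q)\<^sup>T"
  proof (rule eq_matI)
    fix a b assume "a < dim_row (U p * ?B * (U q)\<^sup>T)" "b < dim_col (U p * ?B * (U q)\<^sup>T)"
    then have ab: "a < n p" "b < n q" using Up Uq by auto
    let ?j = "\<kappa>(p := a, q := b)"
    let ?f = "\<lambda>x y m. U p $$ (a, x) * (U q $$ (b, y) * (\<Prod>t\<in>?D. U t $$ (\<kappa> t, m t))) * G (m(p := x, q := y))"
    have "?j \<in> tensor_index d n"
      using \<kappa> ab pq by (auto simp: slice_index_def tensor_index_def PiE_iff extensional_def)
    then have "multilinear_mult d U G ?j = (\<Sum>i\<in>tensor_index d rs. (\<Prod>t\<in>{1..d}. U t $$ (?j t, i t)) * G i)"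
      by (simp add: multilinear_mult_def rows cols)
    also have "\<dots> = (\<Sum>(x, y, m)\<in>{..<rs p} \<times> {..<rs q} \<times> ?K. ?f x y m)"
    \<comment> \<open>A multi-index corresponds to its entries at p and q and its restriction to the
      other modes; \<open>restrict\<close> keeps that part undefined off its domain, as membership
      in \<open>?K\<close> requires.\<close>
    proof (rule sum.reindex_bij_witness[where
          i = "\<lambda>(x, y, m). m(p := x, q := y)" and j = "\<lambda>i. (i p, i q, restrict i ?D)"])
      fix i assume i: "i \<in> tensor_index d rs"
      show eq: "(case (i p, i q, restrict i ?D) of (x, y, m) \<Rightarrow> m(p := x, q := y)) = i"
        using i pq by (auto simp: tensor_index_def PiE_iff extensional_def fun_eq_iff)
      show "(i p, i q, restrict i ?D) \<in> {..<rs p} \<times> {..<rs q} \<times> ?K"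
        using i pq by (auto simp: tensor_index_def slice_index_def PiE_iff)
      have "(\<Prod>t\<in>{1..d}. U t $$ (?j t, i t))
          = U p $$ (a, i p) * (U q $$ (b, i q) * (\<Prod>t\<in>?D. U t $$ (\<kappa> t, restrict i ?D t)))"
        using pq by (subst ins) (auto intro!: prod.cong)
      then show "(case (i p, i q, restrict i ?D) of (x, y, m) \<Rightarrow> ?f x y m)
          = (\<Prod>t\<in>{1..d}. U t $$ (?j t, i t)) * G i"
        using eq by simp
    next
      fix b assume "b \<in> {..<rs p} \<times> {..<rs q} \<times> ?K"
      then obtain x y m where b: "b = (x, y, m)" "x < rs p" "y < rs q" "m \<in> ?K" by auto
      show "((case b of (x, y, m) \<Rightarrow> m(p := x, q := y)) p,
          (case b of (x, y, m) \<Rightarrow> m(p := x, q := y)) q,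
          restrict (case b of (x, y, m) \<Rightarrow> m(p := x, q := y)) ?D) = b"
        using b pq by (auto simp: slice_index_def PiE_iff extensional_def fun_eq_iff)
      show "(case b of (x, y, m) \<Rightarrow> m(p := x, q := y)) \<in> tensor_index d rs"
        using b pq by (auto simp: tensor_index_def slice_index_def PiE_iff extensional_def)
    qed
    also have "\<dots> = (\<Sum>x<rs p. \<Sum>y<rs q. \<Sum>m\<in>?K. ?f x y m)"
      by (simp add: sum.cartesian_product)
    also have "\<dots> = (\<Sum>x<rs p. \<Sum>y<rs q. U p $$ (a, x) * ?B $$ (x, y) * U q $$ (b, y))"
      by (intro sum.cong refl) (simp add: sum_distrib_left sum_distrib_right mult_ac)
    also have "\<dots> = (\<Sum>y<rs q. (\<Sum>x<rs p. U p $$ (a, x) * ?B $$ (x, y)) * U q $$ (b, y))"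
      by (subst sum.swap) (simp only: sum_distrib_right)
    also have "\<dots> = (\<Sum>y<rs q. (U p * ?B) $$ (a, y) * (U q)\<^sup>T $$ (y, b))"
      using ab Up Uq
      by (intro sum.cong refl arg_cong2[where f = "(*)"]) (auto simp: scalar_prod_def lessThan_atLeast0)
    also have "\<dots> = (U p * ?B * (U q)\<^sup>T) $$ (a, b)"
      using ab Up Uq by (intro index_mult_mat_sum[symmetric]) auto
    finally show "slice n (multilinear_mult d U G) p q \<kappa> $$ (a, b) = (U p * ?B * (U q)\<^sup>T) $$ (a, b)"
      using ab by (simp add: slice_def)
  qed (use Up Uq in \<open>auto simp: slice_def\<close>)
qed

theorem theorem6p9:
  fixes d r :: nat
    and n rs :: "nat \<Rightarrow> nat"
    and T G Gs :: "(nat \<Rightarrow> nat) \<Rightarrow> real"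
    and U Us S :: "nat \<Rightarrow> real mat"
    and k :: "nat \<Rightarrow> nat \<Rightarrow> nat"
  assumes "d \<ge> 3"
    and "T \<in> tensors d n"
    and "G \<in> tensors d rs"
    and "rs 1 = r" and "rs 2 = r"
    and "\<And>i. i \<in> {1..d} \<Longrightarrow> U i \<in> carrier_mat (n i) (rs i)"
    and "\<And>i. i \<in> {1..d} \<Longrightarrow> nonneg_mat (U i)"
    and "\<And>i. i \<in> {1..d} \<Longrightarrow> unit_col_sums (U i)"
    and "T = multilinear_mult d U G"
    and "\<And>i. i \<in> {1..d} \<Longrightarrow> SSC (U i)"
    and "\<And>i. i \<in> {2..d} \<Longrightarrow> k i \<in> slice_index d n 1 i"
    and "\<And>i. i \<in> {2..d} \<Longrightarrow> vec_space.rank (n 1) (slice n T 1 i (k i)) = rs i"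
    and step1: "is_arg_min (\<lambda>(V1, V2, R). \<bar>Determinant.det R\<bar>)
        (feasible_trifactorization r (slice n T 1 2 (k 2)))
        (Us 1, Us 2, S 2)"
    and step2: "\<And>i. i \<in> {3..d} \<Longrightarrow> is_arg_min (\<lambda>(V, R). Determinant.det (R\<^sup>T * R))
        (feasible_bifactorization (rs i) (mp_inverse (Us 1) * slice n T 1 i (k i)))
        (Us i, S i)"
    and step3: "Gs = multilinear_mult d (\<lambda>i. mp_inverse (Us i)) T"
  shows "\<exists>P. (\<forall>i\<in>{1..d}. permutation_mat (rs i) (P i) \<and> Us i = U i * P i) \<and>
    Gs = multilinear_mult d (\<lambda>i. (P i)\<^sup>T) G"
proof -
  note rs12 = assms(4,5) and Uc = assms(6) and sums = assms(8) and T = assms(9) and ssc = assms(10)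
  let ?M = "\<lambda>i. slice n T 1 i (k i)"
  have one: "1 \<in> {1..d}" and two: "2 \<in> {1..d}" "2 \<in> {2..d}" using assms(1) by auto
  have U1: "U 1 \<in> carrier_mat (n 1) r" and U2: "U 2 \<in> carrier_mat (n 2) r"
    using Uc[OF one] Uc[OF two(1)] rs12 by simp_all
  have fact: "\<exists>B \<in> carrier_mat r (rs i). ?M i = U 1 * B * (U i)\<^sup>T" if "i \<in> {2..d}" for i
    using slice_multilinear_mult[where d = d and U = U and n = n and rs = rs and G = G
        and p = 1 and q = i and \<kappa> = "k i"] Uc assms(11)[OF that] that
    unfolding T rs12(1) by auto
  have "\<exists>P1 P2. permutation_mat r P1 \<and> permutation_mat r P2 \<and> Us 1 = U 1 * P1 \<and> Us 2 = U 2 * P2"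
  proof -
    obtain B where B: "B \<in> carrier_mat r r" "?M 2 = U 1 * B * (U 2)\<^sup>T"
      using fact[OF two(2)] rs12 by auto
    have "vec_space.rank (n 1) (?M 2) = r" using assms(12)[OF two(2)] rs12 by simp
    then show ?thesis
      using trifactorization_unique[OF U1 ssc[OF one] sums[OF one] U2 ssc[OF two(1)] sums[OF two(1)]
          B _ step1] by blast
  qed
  then obtain P1 P2 where P1: "permutation_mat r P1" "Us 1 = U 1 * P1"
    and P2: "permutation_mat r P2" "Us 2 = U 2 * P2" by blast
  note P1c = permutation_mat_inverse[OF P1(1)]
  have compress: "\<exists>L \<in> carrier_mat (rs i) (n 1). \<exists>E \<in> carrier_mat (n i) (rs i). L * ?M i * E = 1\<^sub>m (rs i)"
    if "i \<in> {2..d}" for i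
    by (rule full_rank_compression[OF _ assms(12)[OF that]]) (simp add: slice_def)
  have left_inv: "\<exists>A \<in> carrier_mat (rs i) (n i). A * U i = 1\<^sub>m (rs i)" if i: "i \<in> {2..d}" for i
  proof -
    obtain B where B: "B \<in> carrier_mat r (rs i)" "?M i = U 1 * B * (U i)\<^sup>T" using fact[OF i] by blast
    obtain L E where L: "L \<in> carrier_mat (rs i) (n 1)" and E: "E \<in> carrier_mat (n i) (rs i)"
      and LE: "L * ?M i * E = 1\<^sub>m (rs i)" using compress[OF i] by blast
    have Ui: "U i \<in> carrier_mat (n i) (rs i)" using Uc i by auto
    then have Uit: "(U i)\<^sup>T \<in> carrier_mat (rs i) (n i)" by simp
    \<comment> \<open>\<open>U i\<close> enters the slice transposed on the right, so the slice
      supplies a right inverse of the transpose.\<close>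
    obtain W where W: "W \<in> carrier_mat (n i) (rs i)" "(U i)\<^sup>T * W = 1\<^sub>m (rs i)"
      using full_rank_factor_inverses(2)[OF mult_carrier_mat[OF U1 B(1)] Uit L E] LE B(2) by auto
    have "W\<^sup>T * U i = 1\<^sub>m (rs i)"
      using arg_cong[OF W(2), of transpose_mat] transpose_mult[OF Uit W(1)] by simp
    moreover have "W\<^sup>T \<in> carrier_mat (rs i) (n i)" using W(1) by simp
    ultimately show ?thesis by blast
  qed
  \<comment> \<open>Mode 1 is the left factor of every slice; the [1,2]-slice is bracketed as U1 (B
    U2^T) to invert it.\<close>
  have "\<exists>A \<in> carrier_mat r (n 1). A * U 1 = 1\<^sub>m r"
  proof -
    obtain B where B: "B \<in> carrier_mat r r" "?M 2 = U 1 * B * (U 2)\<^sup>T"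
      using fact[OF two(2)] rs12 by auto
    obtain L E where L: "L \<in> carrier_mat r (n 1)" and E: "E \<in> carrier_mat (n 2) r"
      and LE: "L * ?M 2 * E = 1\<^sub>m r" using compress[OF two(2)] rs12 by auto
    have U2t: "(U 2)\<^sup>T \<in> carrier_mat r (n 2)" using U2 by simp
    have "L * (U 1 * (B * (U 2)\<^sup>T)) * E = 1\<^sub>m r"
      using LE B(2) assoc_mult_mat[OF U1 B(1) U2t] by simp
    then show ?thesis
      by (rule full_rank_factor_inverses(1)[OF U1 mult_carrier_mat[OF B(1) U2t] L E])
  qed
  then obtain A where A: "A \<in> carrier_mat r (n 1)" "A * U 1 = 1\<^sub>m r" by blast
  have left_inv: "\<exists>A \<in> carrier_mat (rs i) (n i). A * U i = 1\<^sub>m (rs i)" if "i \<in> {1..d}" for i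
    using left_inv[of i] A rs12(1) that by (cases "i = 1") auto
  note X = mp_inverse_mult_permutation[OF U1 A P1(1), folded P1(2)]
  have step2': "\<exists>P. permutation_mat (rs i) P \<and> Us i = U i * P" if i: "i \<in> {3..d}" for i
  proof -
    have i2: "i \<in> {2..d}" and i1: "i \<in> {1..d}" using i by auto
    obtain B where B: "B \<in> carrier_mat r (rs i)" and M: "?M i = U 1 * B * (U i)\<^sup>T"
      using fact[OF i2] by blast
    obtain L E where L: "L \<in> carrier_mat (rs i) (n 1)" and E: "E \<in> carrier_mat (n i) (rs i)"
      and LE: "L * ?M i * E = 1\<^sub>m (rs i)" using compress[OF i2] by blast
    have Uit: "(U i)\<^sup>T \<in> carrier_mat (rs i) (n i)" using Uc[OF i1] by simp
    have P1t: "P1\<^sup>T \<in> carrier_mat r r" using P1c(1) by simp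
    let ?N = "mp_inverse (Us 1) * ?M i"
    have U1B: "U 1 * B \<in> carrier_mat (n 1) (rs i)" using U1 B by simp
    have M': "?M i \<in> carrier_mat (n 1) (n i)" using mult_carrier_mat[OF U1B Uit] M by simp
    have Us1: "Us 1 \<in> carrier_mat (n 1) r" using P1(2) mult_carrier_mat[OF U1 P1c(1)] by simp
    have "?N = mp_inverse (Us 1) * (U 1 * B) * (U i)\<^sup>T"
      unfolding M by (rule assoc_mult_mat[OF X(1) U1B Uit, symmetric])
    also have "mp_inverse (Us 1) * (U 1 * B) = P1\<^sup>T * B"
      using assoc_mult_mat[OF X(1) U1 B] X(2) by simp
    finally have N: "?N = P1\<^sup>T * B * (U i)\<^sup>T" .
    have P1tB: "P1\<^sup>T * B \<in> carrier_mat r (rs i)" using P1t B by simp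
    have Nc: "?N \<in> carrier_mat r (n i)" using X(1) M' by simp
    \<comment> \<open>The columns of the slice lie in the column space of \<open>Us 1\<close>, so
      multiplying \<open>?N\<close> by \<open>Us 1\<close> restores the slice. Hence
      \<open>L * Us 1\<close> compresses \<open>?N\<close> as \<open>L\<close> compresses the
      slice.\<close>
    have "Us 1 * (P1\<^sup>T * B) = U 1 * (P1 * (P1\<^sup>T * B))"
      unfolding P1(2) by (rule assoc_mult_mat[OF U1 P1c(1) P1tB])
    also have "P1 * (P1\<^sup>T * B) = B"
      using assoc_mult_mat[OF P1c(1) P1t B] P1c(3) left_mult_one_mat[OF B] by simp
    finally have "Us 1 * ?N = ?M i"
      using assoc_mult_mat[OF Us1 P1tB Uit] unfolding N unfolding M by simp
    then have "L * Us 1 * ?N * E = 1\<^sub>m (rs i)"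
      using assoc_mult_mat[OF L Us1 Nc] LE by simp
    then show ?thesis
      by (rule bifactorization_unique[OF Uc[OF i1] ssc[OF i1] sums[OF i1] P1tB N
            mult_carrier_mat[OF L Us1] E _ step2[OF i]])
  qed
  have "\<exists>P. permutation_mat (rs i) P \<and> Us i = U i * P" if "i \<in> {1..d}" for i
  proof -
    have "i = 1 \<or> i = 2 \<or> i \<in> {3..d}" using that by auto
    then show ?thesis using P1 P2 rs12 step2' by auto
  qed
  then obtain P where P: "\<And>i. i \<in> {1..d} \<Longrightarrow> permutation_mat (rs i) (P i) \<and> Us i = U i * P i"
    by metis
  have mp: "dim_col (mp_inverse (Us i)) = dim_row (U i)" "mp_inverse (Us i) * U i = (P i)\<^sup>T"
    if i: "i \<in> {1..d}" for i
  proof -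
    obtain A where "A \<in> carrier_mat (rs i) (n i)" "A * U i = 1\<^sub>m (rs i)" using left_inv[OF i] by blast
    note Y = mp_inverse_mult_permutation[OF Uc[OF i] this, of "P i"]
    show "dim_col (mp_inverse (Us i)) = dim_row (U i)" "mp_inverse (Us i) * U i = (P i)\<^sup>T"
      using Y P[OF i] Uc[OF i] by auto
  qed
  have "Gs = multilinear_mult d (\<lambda>i. mp_inverse (Us i) * U i) G"
    unfolding step3 T by (rule multilinear_mult_comp) (rule mp(1))
  also have "\<dots> = multilinear_mult d (\<lambda>i. (P i)\<^sup>T) G"
    by (rule multilinear_mult_cong) (rule mp(2))
  finally show ?thesis using P by blast
qed

end
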